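(* For each $n\in\mathbb{N}$, the theories $\mathrm{WR}(\Sigma_{n+1}\wedge\Pi_{n+1})$ and $\mathrm{I}\Sigma_{n+2}$ are equivalent (each proves every axiom of the other).
   Context: All theories contain $\mathrm{PA}^-$; $\mathrm{I}\Sigma_k$ is the $\Sigma_k$-induction scheme. $\Sigma_{k}\wedge\Pi_{k}$ is the class of conjunctions of a $\Sigma_k$ and a $\Pi_k$ formula. For a formula $\phi(x,y)$ (possibly with further free variables), $\mathrm{WR}\phi$ is the universal closure of $\forall x\,\exists y<a\,\phi(x,y)\to\exists y<a\,\forall b\,\exists x>b\,\phi(x,y)$, and $\mathrm{WR}\Gamma=\mathrm{I}\Delta_0\cup\{\mathrm{WR}\phi:\phi\in\Gamma\}$. *)

theory Defs
  imports Main
begin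

datatype trm = TVar nat | TZero | TOne | TPlus trm trm | TTimes trm trm

datatype fm = FEq trm trm | FLt trm trm | FNeg fm | FAnd fm fm | FOr fm fm
  | FImp fm fm | FAll fm | FEx fm

fun lift_tm :: "nat \<Rightarrow> trm \<Rightarrow> trm" where
  "lift_tm c (TVar i) = (if i < c then TVar i else TVar (Suc i))"
| "lift_tm c TZero = TZero"
| "lift_tm c TOne = TOne"
| "lift_tm c (TPlus s t) = TPlus (lift_tm c s) (lift_tm c t)"
| "lift_tm c (TTimes s t) = TTimes (lift_tm c s) (lift_tm c t)"

fun lift_fm :: "nat \<Rightarrow> fm \<Rightarrow> fm" where
  "lift_fm c (FEq s t) = FEq (lift_tm c s) (lift_tm c t)"
| "lift_fm c (FLt s t) = FLt (lift_tm c s) (lift_tm c t)"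
| "lift_fm c (FNeg p) = FNeg (lift_fm c p)"
| "lift_fm c (FAnd p q) = FAnd (lift_fm c p) (lift_fm c q)"
| "lift_fm c (FOr p q) = FOr (lift_fm c p) (lift_fm c q)"
| "lift_fm c (FImp p q) = FImp (lift_fm c p) (lift_fm c q)"
| "lift_fm c (FAll p) = FAll (lift_fm (Suc c) p)"
| "lift_fm c (FEx p) = FEx (lift_fm (Suc c) p)"

fun subst_tm :: "nat \<Rightarrow> trm \<Rightarrow> trm \<Rightarrow> trm" where
  "subst_tm k s (TVar i) = (if i < k then TVar i else if i = k then s else TVar (i - 1))"
| "subst_tm k s TZero = TZero"
| "subst_tm k s TOne = TOne"
| "subst_tm k s (TPlus a b) = TPlus (subst_tm k s a) (subst_tm k s b)"
| "subst_tm k s (TTimes a b) = TTimes (subst_tm k s a) (subst_tm k s b)"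

fun subst_fm :: "nat \<Rightarrow> trm \<Rightarrow> fm \<Rightarrow> fm" where
  "subst_fm k s (FEq a b) = FEq (subst_tm k s a) (subst_tm k s b)"
| "subst_fm k s (FLt a b) = FLt (subst_tm k s a) (subst_tm k s b)"
| "subst_fm k s (FNeg p) = FNeg (subst_fm k s p)"
| "subst_fm k s (FAnd p q) = FAnd (subst_fm k s p) (subst_fm k s q)"
| "subst_fm k s (FOr p q) = FOr (subst_fm k s p) (subst_fm k s q)"
| "subst_fm k s (FImp p q) = FImp (subst_fm k s p) (subst_fm k s q)"
| "subst_fm k s (FAll p) = FAll (subst_fm (Suc k) (lift_tm 0 s) p)"
| "subst_fm k s (FEx p) = FEx (subst_fm (Suc k) (lift_tm 0 s) p)"

definition shiftr :: "(nat \<Rightarrow> nat) \<Rightarrow> nat \<Rightarrow> nat" where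
  "shiftr f i = (case i of 0 \<Rightarrow> 0 | Suc j \<Rightarrow> Suc (f j))"

fun rename_tm :: "(nat \<Rightarrow> nat) \<Rightarrow> trm \<Rightarrow> trm" where
  "rename_tm f (TVar i) = TVar (f i)"
| "rename_tm f TZero = TZero"
| "rename_tm f TOne = TOne"
| "rename_tm f (TPlus a b) = TPlus (rename_tm f a) (rename_tm f b)"
| "rename_tm f (TTimes a b) = TTimes (rename_tm f a) (rename_tm f b)"

fun rename_fm :: "(nat \<Rightarrow> nat) \<Rightarrow> fm \<Rightarrow> fm" where
  "rename_fm f (FEq a b) = FEq (rename_tm f a) (rename_tm f b)"
| "rename_fm f (FLt a b) = FLt (rename_tm f a) (rename_tm f b)"
| "rename_fm f (FNeg p) = FNeg (rename_fm f p)"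
| "rename_fm f (FAnd p q) = FAnd (rename_fm f p) (rename_fm f q)"
| "rename_fm f (FOr p q) = FOr (rename_fm f p) (rename_fm f q)"
| "rename_fm f (FImp p q) = FImp (rename_fm f p) (rename_fm f q)"
| "rename_fm f (FAll p) = FAll (rename_fm (shiftr f) p)"
| "rename_fm f (FEx p) = FEx (rename_fm (shiftr f) p)"

fun fv_tm :: "trm \<Rightarrow> nat set" where
  "fv_tm (TVar i) = {i}"
| "fv_tm TZero = {}"
| "fv_tm TOne = {}"
| "fv_tm (TPlus a b) = fv_tm a \<union> fv_tm b"
| "fv_tm (TTimes a b) = fv_tm a \<union> fv_tm b"

fun fv_fm :: "fm \<Rightarrow> nat set" where
  "fv_fm (FEq a b) = fv_tm a \<union> fv_tm b"
| "fv_fm (FLt a b) = fv_tm a \<union> fv_tm b"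
| "fv_fm (FNeg p) = fv_fm p"
| "fv_fm (FAnd p q) = fv_fm p \<union> fv_fm q"
| "fv_fm (FOr p q) = fv_fm p \<union> fv_fm q"
| "fv_fm (FImp p q) = fv_fm p \<union> fv_fm q"
| "fv_fm (FAll p) = (\<lambda>i. i - 1) ` (fv_fm p - {0})"
| "fv_fm (FEx p) = (\<lambda>i. i - 1) ` (fv_fm p - {0})"

definition close :: "fm \<Rightarrow> fm" where
  "close p = (FAll ^^ (if fv_fm p = {} then 0 else Suc (Max (fv_fm p)))) p"

fun pval :: "(fm \<Rightarrow> bool) \<Rightarrow> fm \<Rightarrow> bool" where
  "pval v (FNeg p) = (\<not> pval v p)"
| "pval v (FAnd p q) = (pval v p \<and> pval v q)"
| "pval v (FOr p q) = (pval v p \<or> pval v q)"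
| "pval v (FImp p q) = (pval v p \<longrightarrow> pval v q)"
| "pval v (FEq a b) = v (FEq a b)"
| "pval v (FLt a b) = v (FLt a b)"
| "pval v (FAll p) = v (FAll p)"
| "pval v (FEx p) = v (FEx p)"

inductive prv :: "fm set \<Rightarrow> fm \<Rightarrow> bool" for T :: "fm set" where
  ax: "p \<in> T \<Longrightarrow> prv T p"
| taut: "(\<forall>v. pval v p) \<Longrightarrow> prv T p"
| mp: "prv T (FImp p q) \<Longrightarrow> prv T p \<Longrightarrow> prv T q"
| all_inst: "prv T (FImp (FAll p) (subst_fm 0 t p))"
| gen: "prv T (FImp (lift_fm 0 q) p) \<Longrightarrow> prv T (FImp q (FAll p))"
| ex_def1: "prv T (FImp (FEx p) (FNeg (FAll (FNeg p))))"
| ex_def2: "prv T (FImp (FNeg (FAll (FNeg p))) (FEx p))"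
| eq_refl: "prv T (FEq t t)"
| eq_subst: "prv T (FImp (FEq s t) (FImp (subst_fm 0 s p) (subst_fm 0 t p)))"

inductive delta0 :: "fm \<Rightarrow> bool" where
  "delta0 (FEq a b)"
| "delta0 (FLt a b)"
| "delta0 p \<Longrightarrow> delta0 (FNeg p)"
| "delta0 p \<Longrightarrow> delta0 q \<Longrightarrow> delta0 (FAnd p q)"
| "delta0 p \<Longrightarrow> delta0 q \<Longrightarrow> delta0 (FOr p q)"
| "delta0 p \<Longrightarrow> delta0 q \<Longrightarrow> delta0 (FImp p q)"
| "delta0 p \<Longrightarrow> delta0 (FAll (FImp (FLt (TVar 0) (lift_tm 0 t)) p))"
| "delta0 p \<Longrightarrow> delta0 (FEx (FAnd (FLt (TVar 0) (lift_tm 0 t)) p))"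

inductive sigma and pi :: "nat \<Rightarrow> fm \<Rightarrow> bool" where
  "delta0 p \<Longrightarrow> sigma 0 p"
| "delta0 p \<Longrightarrow> pi 0 p"
| "pi n p \<Longrightarrow> sigma (Suc n) p"
| "sigma n p \<Longrightarrow> pi (Suc n) p"
| "sigma (Suc n) p \<Longrightarrow> sigma (Suc n) (FEx p)"
| "pi (Suc n) p \<Longrightarrow> pi (Suc n) (FAll p)"

definition sigma_and_pi :: "nat \<Rightarrow> fm \<Rightarrow> bool" where
  "sigma_and_pi k p = (\<exists>s q. sigma k s \<and> pi k q \<and> p = FAnd s q)"

abbreviation "vx \<equiv> TVar 0"
abbreviation "vy \<equiv> TVar 1"
abbreviation "vz \<equiv> TVar 2"

definition PAminus :: "fm set" where
  "PAminus = close ` {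
     FEq (TPlus (TPlus vx vy) vz) (TPlus vx (TPlus vy vz)),
     FEq (TPlus vx vy) (TPlus vy vx),
     FEq (TTimes (TTimes vx vy) vz) (TTimes vx (TTimes vy vz)),
     FEq (TTimes vx vy) (TTimes vy vx),
     FEq (TTimes vx (TPlus vy vz)) (TPlus (TTimes vx vy) (TTimes vx vz)),
     FAnd (FEq (TPlus vx TZero) vx) (FEq (TTimes vx TZero) TZero),
     FEq (TTimes vx TOne) vx,
     FImp (FAnd (FLt vx vy) (FLt vy vz)) (FLt vx vz),
     FNeg (FLt vx vx),
     FOr (FLt vx vy) (FOr (FEq vx vy) (FLt vy vx)),
     FImp (FLt vx vy) (FLt (TPlus vx vz) (TPlus vy vz)),
     FImp (FAnd (FLt TZero vz) (FLt vx vy)) (FLt (TTimes vx vz) (TTimes vy vz)),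
     FImp (FLt vx vy) (FEx (FEq (TPlus (TVar 1) (TVar 0)) (TVar 2))),
     FAnd (FLt TZero TOne) (FImp (FLt TZero vx) (FOr (FLt TOne vx) (FEq TOne vx))),
     FOr (FLt TZero vx) (FEq TZero vx) }"

text \<open>Substitute t for variable 0, leaving the other free variables unchanged.\<close>
definition inst0 :: "fm \<Rightarrow> trm \<Rightarrow> fm" where
  "inst0 p t = subst_fm 0 t (lift_fm 1 p)"

definition ind :: "fm \<Rightarrow> fm" where
  "ind p = FImp (FAnd (subst_fm 0 TZero p) (FAll (FImp p (inst0 p (TPlus (TVar 0) TOne)))))
                (FAll p)"

definition ISigma :: "nat \<Rightarrow> fm set" where
  "ISigma k = PAminus \<union> {close (ind p) | p. sigma k p}"

definition IDelta0 :: "fm set" where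
  "IDelta0 = PAminus \<union> {close (ind p) | p. delta0 p}"

text \<open>WR p for p(x, y, params) with x = index 0, y = index 1, params = indices 2,3,...:
  closure of  (\<forall>x \<exists>y<a p(x,y)) \<longrightarrow> (\<exists>y<a \<forall>b \<exists>x>b p(x,y)),  a a fresh variable.\<close>
definition WR :: "fm \<Rightarrow> fm" where
  "WR p = close (FImp
     (FAll (FEx (FAnd (FLt (TVar 0) (TVar 2))
        (rename_fm (\<lambda>i. if i = 0 then 1 else if i = 1 then 0 else i + 1) p))))
     (FEx (FAnd (FLt (TVar 0) (TVar 1))
        (FAll (FEx (FAnd (FLt (TVar 1) (TVar 0))
           (rename_fm (\<lambda>i. if i = 0 then 0 else if i = 1 then 2 else i + 2) p)))))))"

definition WR_thy :: "(fm \<Rightarrow> bool) \<Rightarrow> fm set" where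
  "WR_thy \<Gamma> = IDelta0 \<union> {WR p | p. \<Gamma> p}"

end

theory Submission
  imports Defs "HOL-Library.Countable_Set"
begin

text \<open>By a Henkin completeness theorem it suffices to compare the models of the two theories.

  From weak regularity for level k (Sigma_k and Pi_k) and Sigma_k induction one gets Sigma_{k+1}
  induction, so that induction climbs from level 0 to n + 2.  If a proper cut is closed under
  successor and defined by the formula "some u satisfies theta(u,y)" with theta in Pi_k, colour x
  by the least y having no witness u < x.  A colour taken by unboundedly many x would be the least
  element outside the cut.

  Conversely let sigma be in Sigma_{k+1}, rho in Pi_{k+1} and let every x have a colour y < a with
  sigma(x,y) and rho(x,y).  By Sigma_{k+2} induction choose a maximal set J of colours
  such that rho(x,y) fails simultaneously for all y in J at unboundedly many x.  For a colour y
  outside J, maximality makes rho(x,y) true at almost all of those x, so if all colours were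
  bounded then sigma(x,y) would fail at almost all of them.  This is a Pi_{k+1} condition on the
  bound, so Sigma_{k+2} collection applies and one of those x gets no colour.  The sets J are coded
  by divisors of a common multiple of pairwise coprime moduli.\<close>

section \<open>Renaming and substitution\<close>

text \<open>The conjunction class comes from the colouring by least elements: that y has no witness
  below x is a Sigma_k condition, that every z < y has one is a Pi_k condition.

  In the converse, collection cannot be applied to the bounds for sigma and rho together, since
  "beyond w no x satisfies both" is not a Pi condition of the right level. The set J removes rho:
  beyond some bound rho is settled by membership in J, and only sigma remains. As the level k + 1 is
  positive, the unbounded quantifier over x is absorbed by the Pi class.

  No comprehension for sets J is required, only a maximal code and the passage from J to J with at
  most one further colour. Multiplying a divisor by one modulus does this, so neither exponentiation
  nor sequence coding enters.

  The classes \<open>sigma\<close> and \<open>pi\<close> are purely syntactic quantifier prefixes.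
  Closure under connectives holds only up to equivalence, and closure under bounded quantifiers only
  in models with enough induction. For this reason the arithmetic is done with definable predicates
  in a fixed model rather than with formulas.\<close>

lemma finite_fv_tm: "finite (fv_tm t)"
  by (induction t) auto

lemma finite_fv_fm: "finite (fv_fm p)"
  by (induction p) (auto simp: finite_fv_tm)

lemma shiftr_simps [simp]: "shiftr f 0 = 0" "shiftr f (Suc i) = Suc (f i)"
  by (simp_all add: shiftr_def)

lemma shiftr_comp: "shiftr f \<circ> shiftr g = shiftr (f \<circ> g)"
  by (rule ext) (simp add: shiftr_def split: nat.split)

lemma rename_tm_cong: "(\<And>i. i \<in> fv_tm t \<Longrightarrow> f i = g i) \<Longrightarrow> rename_tm f t = rename_tm g t"
  by (induction t) auto

lemma shiftr_eq_on_fv: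
  assumes "\<And>i. i \<in> (\<lambda>i. i - 1) ` (A - {0}) \<Longrightarrow> f i = g i" "i \<in> A"
  shows "shiftr f i = shiftr g i"
proof (cases i)
  case (Suc j)
  then have "j \<in> (\<lambda>i. i - 1) ` (A - {0})" using assms(2) by force
  from assms(1)[OF this] show ?thesis unfolding Suc by simp
qed simp

lemma rename_fm_cong: "(\<And>i. i \<in> fv_fm p \<Longrightarrow> f i = g i) \<Longrightarrow> rename_fm f p = rename_fm g p"
proof (induction p arbitrary: f g)
  case (FEq a b)
  have "rename_tm f a = rename_tm g a"
    by (rule rename_tm_cong, rule FEq.prems, simp)
  moreover have "rename_tm f b = rename_tm g b"
    by (rule rename_tm_cong, rule FEq.prems, simp)
  ultimately show ?case by (simp only: rename_fm.simps)
next
  case (FLt a b)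
  have "rename_tm f a = rename_tm g a"
    by (rule rename_tm_cong, rule FLt.prems, simp)
  moreover have "rename_tm f b = rename_tm g b"
    by (rule rename_tm_cong, rule FLt.prems, simp)
  ultimately show ?case by (simp only: rename_fm.simps)
next
  case (FAnd p q)
  have "rename_fm f p = rename_fm g p"
    by (rule FAnd.IH(1), rule FAnd.prems, simp)
  moreover have "rename_fm f q = rename_fm g q"
    by (rule FAnd.IH(2), rule FAnd.prems, simp)
  ultimately show ?case by (simp only: rename_fm.simps)
next
  case (FOr p q)
  have "rename_fm f p = rename_fm g p"
    by (rule FOr.IH(1), rule FOr.prems, simp)
  moreover have "rename_fm f q = rename_fm g q"
    by (rule FOr.IH(2), rule FOr.prems, simp)
  ultimately show ?case by (simp only: rename_fm.simps)
next
  case (FImp p q)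
  have "rename_fm f p = rename_fm g p"
    by (rule FImp.IH(1), rule FImp.prems, simp)
  moreover have "rename_fm f q = rename_fm g q"
    by (rule FImp.IH(2), rule FImp.prems, simp)
  ultimately show ?case by (simp only: rename_fm.simps)
next
  case (FNeg p)
  have "rename_fm f p = rename_fm g p"
    by (rule FNeg.IH, rule FNeg.prems, simp)
  then show ?case by (simp only: rename_fm.simps)
next
  case (FAll p)
  have "rename_fm (shiftr f) p = rename_fm (shiftr g) p"
  proof (rule FAll.IH, rule shiftr_eq_on_fv)
    show "f i = g i" if "i \<in> (\<lambda>i. i - 1) ` (fv_fm p - {0})" for i
      by (rule FAll.prems) (use that in \<open>simp only: fv_fm.simps\<close>)
  qed assumption
  then show ?case by (simp only: rename_fm.simps)
next
  case (FEx p)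
  have "rename_fm (shiftr f) p = rename_fm (shiftr g) p"
  proof (rule FEx.IH, rule shiftr_eq_on_fv)
    show "f i = g i" if "i \<in> (\<lambda>i. i - 1) ` (fv_fm p - {0})" for i
      by (rule FEx.prems) (use that in \<open>simp only: fv_fm.simps\<close>)
  qed assumption
  then show ?case by (simp only: rename_fm.simps)
qed

lemma rename_tm_comp: "rename_tm f (rename_tm g t) = rename_tm (f \<circ> g) t"
  by (induction t) auto

lemma rename_fm_comp: "rename_fm f (rename_fm g p) = rename_fm (f \<circ> g) p"
  by (induction p arbitrary: f g) (auto simp: rename_tm_comp shiftr_comp)

lemma shiftr_ident [simp]: "shiftr (\<lambda>i. i) = (\<lambda>i. i)"
  by (rule ext) (simp add: shiftr_def split: nat.split)

lemma rename_tm_ident [simp]: "rename_tm (\<lambda>i. i) t = t"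
  by (induction t) auto

lemma rename_fm_ident [simp]: "rename_fm (\<lambda>i. i) p = p"
  by (induction p) auto

lemma lift_tm_rename: "lift_tm c t = rename_tm (\<lambda>i. if i < c then i else Suc i) t"
  by (induction t) auto

lemma lift_fm_rename: "lift_fm c p = rename_fm (\<lambda>i. if i < c then i else Suc i) p"
proof (induction p arbitrary: c)
  case (FAll p)
  have "shiftr (\<lambda>i. if i < c then i else Suc i) = (\<lambda>i. if i < Suc c then i else Suc i)"
    by (rule ext) (simp add: shiftr_def split: nat.split)
  then show ?case using FAll by simp
next
  case (FEx p)
  have "shiftr (\<lambda>i. if i < c then i else Suc i) = (\<lambda>i. if i < Suc c then i else Suc i)"
    by (rule ext) (simp add: shiftr_def split: nat.split)
  then show ?case using FEx by simp
qed (auto simp: lift_tm_rename)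

lemma subst_tm_var: "subst_tm k (TVar j) t = rename_tm (\<lambda>i. if i < k then i else if i = k then j else i - 1) t"
  by (induction t) auto

text \<open>Together with \<open>lift_fm_rename\<close> this turns lifting and instantiation by a
  variable into renamings, so that their compositions are computed as compositions of functions on
  indices.\<close>

lemma subst_fm_var: "subst_fm k (TVar j) p = rename_fm (\<lambda>i. if i < k then i else if i = k then j else i - 1) p"
proof (induction p arbitrary: k j)
  case (FAll p)
  have "shiftr (\<lambda>i. if i < k then i else if i = k then j else i - 1)
      = (\<lambda>i. if i < Suc k then i else if i = Suc k then Suc j else i - 1)"
    by (rule ext) (auto simp add: shiftr_def split: nat.split)
  then show ?case using FAll by simp
next
  case (FEx p)
  have "shiftr (\<lambda>i. if i < k then i else if i = k then j else i - 1)
      = (\<lambda>i. if i < Suc k then i else if i = Suc k then Suc j else i - 1)"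
    by (rule ext) (auto simp add: shiftr_def split: nat.split)
  then show ?case using FEx by simp
qed (auto simp: subst_tm_var)

lemma subst_lift_tm [simp]: "subst_tm 0 s (lift_tm 0 t) = t"
  by (induction t) auto

lemma rename_shiftr_lift_tm: "rename_tm (shiftr f) (lift_tm 0 t) = lift_tm 0 (rename_tm f t)"
  by (simp add: lift_tm_rename rename_tm_comp comp_def)

lemma rename_shiftr_lift_fm: "rename_fm (shiftr f) (lift_fm 0 p) = lift_fm 0 (rename_fm f p)"
  by (simp add: lift_fm_rename rename_fm_comp comp_def)

text \<open>The k-fold iterate of \<open>shiftr\<close>, in closed form. It is what remains of a
  renaming under k binders, the generality in which \<open>rename_subst_fm\<close> has to be
  proved.\<close>

definition shiftrs :: "nat \<Rightarrow> (nat \<Rightarrow> nat) \<Rightarrow> nat \<Rightarrow> nat" where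
  "shiftrs k f i = (if i < k then i else f (i - k) + k)"

lemma shiftr_shiftrs: "shiftr (shiftrs k f) = shiftrs (Suc k) f"
  by (rule ext) (simp add: shiftr_def shiftrs_def split: nat.split)

lemma rename_subst_tm:
  "rename_tm (shiftrs k f) (subst_tm k t u)
    = subst_tm k (rename_tm (shiftrs k f) t) (rename_tm (shiftrs (Suc k) f) u)"
proof (induction u)
  case (TVar i)
  consider "i < k" | "i = k" | j where "i = Suc (k + j)"
    by (metis less_imp_Suc_add linorder_neqE_nat)
  then show ?case by cases (simp_all add: shiftrs_def)
qed simp_all

lemma rename_subst_fm_shiftrs:
  "rename_fm (shiftrs k f) (subst_fm k t p)
    = subst_fm k (rename_tm (shiftrs k f) t) (rename_fm (shiftrs (Suc k) f) p)"
proof (induction p arbitrary: k t)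
  case (FAll p)
  show ?case using FAll[of "Suc k" "lift_tm 0 t"]
    by (simp add: shiftr_shiftrs flip: rename_shiftr_lift_tm)
next
  case (FEx p)
  show ?case using FEx[of "Suc k" "lift_tm 0 t"]
    by (simp add: shiftr_shiftrs flip: rename_shiftr_lift_tm)
qed (simp_all add: rename_subst_tm)

lemma rename_subst_fm:
  "rename_fm f (subst_fm 0 t p) = subst_fm 0 (rename_tm f t) (rename_fm (shiftr f) p)"
proof -
  have "shiftrs 0 f = f" by (rule ext) (simp add: shiftrs_def)
  then show ?thesis using rename_subst_fm_shiftrs[of 0 f t p] by (simp flip: shiftr_shiftrs)
qed

lemma fv_FAll_pow: "fv_fm ((FAll ^^ n) p) = {i. i + n \<in> fv_fm p}"
proof (induction n)
  case (Suc n)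
  show ?case
  proof (intro set_eqI iffI)
    fix i assume "i \<in> fv_fm ((FAll ^^ Suc n) p)"
    then obtain j where "j \<in> fv_fm ((FAll ^^ n) p)" "j \<noteq> 0" "i = j - 1" by auto
    then show "i \<in> {i. i + Suc n \<in> fv_fm p}" using Suc by (cases j) auto
  next
    fix i assume "i \<in> {i. i + Suc n \<in> fv_fm p}"
    then have "Suc i \<in> fv_fm ((FAll ^^ n) p) - {0}" using Suc by simp
    then show "i \<in> fv_fm ((FAll ^^ Suc n) p)" by (auto intro!: image_eqI[where x = "Suc i"])
  qed
qed simp

lemma fv_close: "fv_fm (close p) = {}"
proof (cases "fv_fm p = {}")
  case False
  have "i + Suc (Max (fv_fm p)) \<notin> fv_fm p" for i
    using Max_ge[OF finite_fv_fm, of "i + Suc (Max (fv_fm p))" p] by auto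
  then show ?thesis using False by (simp add: close_def fv_FAll_pow del: funpow.simps)
qed (simp add: close_def)

lemma size_subst_fm [simp]: "size (subst_fm k t p) = size p"
  by (induction p arbitrary: k t) auto

section \<open>Structures and satisfaction\<close>

record 'd str =
  str_zero :: 'd
  str_one :: 'd
  str_plus :: "'d \<Rightarrow> 'd \<Rightarrow> 'd"
  str_times :: "'d \<Rightarrow> 'd \<Rightarrow> 'd"
  str_less :: "'d \<Rightarrow> 'd \<Rightarrow> bool"

definition scons :: "'d \<Rightarrow> (nat \<Rightarrow> 'd) \<Rightarrow> nat \<Rightarrow> 'd" (infixr "##" 65) where
  "(x ## e) i = (case i of 0 \<Rightarrow> x | Suc j \<Rightarrow> e j)"

lemma scons_simps [simp]: "(x ## e) 0 = x" "(x ## e) (Suc i) = e i"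
  by (simp_all add: scons_def)

lemma scons_numeral [simp]: "(x ## e) 1 = e 0" "(x ## e) (numeral k) = e (pred_numeral k)"
  by (simp_all add: numeral_eq_Suc)

lemma scons_tl [simp]: "e 0 ## (\<lambda>i. e (Suc i)) = e"
  by (rule ext) (simp add: scons_def split: nat.split)

fun tval :: "'d str \<Rightarrow> (nat \<Rightarrow> 'd) \<Rightarrow> trm \<Rightarrow> 'd" where
  "tval M e (TVar i) = e i"
| "tval M e TZero = str_zero M"
| "tval M e TOne = str_one M"
| "tval M e (TPlus s t) = str_plus M (tval M e s) (tval M e t)"
| "tval M e (TTimes s t) = str_times M (tval M e s) (tval M e t)"

fun sat :: "'d str \<Rightarrow> (nat \<Rightarrow> 'd) \<Rightarrow> fm \<Rightarrow> bool" where
  "sat M e (FEq s t) = (tval M e s = tval M e t)"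
| "sat M e (FLt s t) = str_less M (tval M e s) (tval M e t)"
| "sat M e (FNeg p) = (\<not> sat M e p)"
| "sat M e (FAnd p q) = (sat M e p \<and> sat M e q)"
| "sat M e (FOr p q) = (sat M e p \<or> sat M e q)"
| "sat M e (FImp p q) = (sat M e p \<longrightarrow> sat M e q)"
| "sat M e (FAll p) = (\<forall>x. sat M (x ## e) p)"
| "sat M e (FEx p) = (\<exists>x. sat M (x ## e) p)"

lemma tval_rename: "tval M e (rename_tm f t) = tval M (e \<circ> f) t"
  by (induction t) auto

lemma scons_shiftr: "(x ## e) \<circ> shiftr f = x ## (e \<circ> f)"
  by (rule ext) (simp add: shiftr_def scons_def split: nat.split)

lemma sat_rename: "sat M e (rename_fm f p) = sat M (e \<circ> f) p"
  by (induction p arbitrary: e f) (auto simp: tval_rename scons_shiftr)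

lemma tval_lift: "tval M (x ## e) (lift_tm 0 t) = tval M e t"
  by (simp add: lift_tm_rename tval_rename comp_def)

lemma tval_subst:
  "tval M e (subst_tm k s t) = tval M (\<lambda>i. if i < k then e i else if i = k then tval M e s else e (i - 1)) t"
  by (induction t) auto

lemma sat_subst_gen:
  "sat M e (subst_fm k t p) = sat M (\<lambda>i. if i < k then e i else if i = k then tval M e t else e (i - 1)) p"
proof (induction p arbitrary: k t e)
  case (FAll p)
  have "x ## (\<lambda>i. if i < k then e i else if i = k then tval M e t else e (i - 1))
    = (\<lambda>i. if i < Suc k then (x ## e) i else if i = Suc k then tval M (x ## e) (lift_tm 0 t) else (x ## e) (i - 1))" for x
    by (rule ext) (auto simp: tval_lift scons_def split: nat.split)
  then show ?case using FAll by simp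
next
  case (FEx p)
  have "x ## (\<lambda>i. if i < k then e i else if i = k then tval M e t else e (i - 1))
    = (\<lambda>i. if i < Suc k then (x ## e) i else if i = Suc k then tval M (x ## e) (lift_tm 0 t) else (x ## e) (i - 1))" for x
    by (rule ext) (auto simp: tval_lift scons_def split: nat.split)
  then show ?case using FEx by simp
qed (auto simp: tval_subst)

lemma sat_subst: "sat M e (subst_fm 0 t p) = sat M (tval M e t ## e) p"
proof -
  have "(\<lambda>i. if i < 0 then e i else if i = 0 then tval M e t else e (i - 1)) = tval M e t ## e"
    by (rule ext) (auto simp: scons_def split: nat.split)
  then show ?thesis by (simp add: sat_subst_gen)
qed

text \<open>A sentence is fixed by every renaming, in particular by those sending all variables to 0
  or all to 1. Reading both in the environment \<open>e 0 ## e'\<close> compares e with e' without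
  an induction on formulas.\<close>

lemma sat_sentence:
  assumes "fv_fm p = {}" shows "sat M e p = sat M e' p"
proof -
  have "rename_fm (\<lambda>_. 0) p = rename_fm (\<lambda>i. i) p" by (rule rename_fm_cong) (simp add: assms)
  then have *: "sat M e p = sat M (e \<circ> (\<lambda>_. 0)) p" for e
    using sat_rename[of M e "\<lambda>_. 0" p] by simp
  have 2: "rename_fm (\<lambda>_. 0) p = rename_fm (\<lambda>_. 1) p" by (rule rename_fm_cong) (simp add: assms)
  have "sat M (e \<circ> (\<lambda>_. 0)) p = sat M (e \<circ> (\<lambda>_. 1)) p" for e :: "nat \<Rightarrow> _"
    using arg_cong[OF 2, of "sat M e"] by (simp only: sat_rename)
  from this[of "e 0 ## e'"] have "sat M (\<lambda>_. e 0) p = sat M (\<lambda>_. e' 0) p" by (simp add: comp_def)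
  then show ?thesis using *[of e] *[of e'] by (simp add: comp_def)
qed

lemma sat_FAll_pow: "(\<forall>e. sat M e ((FAll ^^ n) p)) = (\<forall>e. sat M e p)"
proof (induction n)
  case (Suc n)
  have "(\<forall>e x. sat M (x ## e) q) = (\<forall>e. sat M e q)" for q
    by (metis scons_tl)
  then show ?case using Suc by simp
qed simp

lemma sat_close: "sat M e (close p) = (\<forall>e. sat M e p)"
proof -
  have "sat M e (close p) = (\<forall>e. sat M e (close p))" using sat_sentence[OF fv_close] by blast
  then show ?thesis by (simp only: close_def sat_FAll_pow)
qed

lemma sat_ind:
  "sat M e (ind p) = (sat M (str_zero M ## e) p \<and>
     (\<forall>x. sat M (x ## e) p \<longrightarrow> sat M (str_plus M x (str_one M) ## e) p) \<longrightarrow> (\<forall>x. sat M (x ## e) p))"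
proof -
  have "(y ## x ## e) \<circ> (\<lambda>i. if i < 1 then i else Suc i) = y ## e" for x y
    by (rule ext) (auto simp: scons_def split: nat.split)
  then show ?thesis
    by (simp add: ind_def inst0_def sat_subst lift_fm_rename sat_rename)
qed

lemma sat_WR:
  "sat M e (WR p) = (\<forall>a e. (\<forall>x. \<exists>y. str_less M y a \<and> sat M (x ## y ## e) p) \<longrightarrow>
     (\<exists>y. str_less M y a \<and> (\<forall>b. \<exists>x. str_less M b x \<and> sat M (x ## y ## e) p)))"
proof -
  have 1: "(y ## x ## e) \<circ> (\<lambda>i. if i = 0 then 1 else if i = 1 then 0 else i + 1) = x ## y ## (\<lambda>i. e (Suc i))" for x y and e :: "nat \<Rightarrow> 'a"
    by (rule ext) (auto simp: scons_def split: nat.split)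
  have 2: "(x ## b ## y ## e) \<circ> (\<lambda>i. if i = 0 then 0 else if i = 1 then 2 else i + 2) = x ## y ## (\<lambda>i. e (Suc i))" for x y b and e :: "nat \<Rightarrow> 'a"
    by (rule ext) (auto simp: scons_def split: nat.split)
  have "sat M e (WR p) = (\<forall>e. (\<forall>x. \<exists>y. str_less M y (e 0) \<and> sat M (x ## y ## (\<lambda>i. e (Suc i))) p) \<longrightarrow>
     (\<exists>y. str_less M y (e 0) \<and> (\<forall>b. \<exists>x. str_less M b x \<and> sat M (x ## y ## (\<lambda>i. e (Suc i))) p)))"
    by (simp add: WR_def sat_close sat_rename 1 2)
  also have "\<dots> = (\<forall>a e. (\<forall>x. \<exists>y. str_less M y a \<and> sat M (x ## y ## e) p) \<longrightarrow>
     (\<exists>y. str_less M y a \<and> (\<forall>b. \<exists>x. str_less M b x \<and> sat M (x ## y ## e) p)))"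
    (is "(\<forall>e. ?Q (e 0) (\<lambda>i. e (Suc i))) = (\<forall>a e. ?Q a e)")
  proof
    assume *: "\<forall>e. ?Q (e 0) (\<lambda>i. e (Suc i))"
    show "\<forall>a e. ?Q a e"
    proof (intro allI)
      fix a and e :: "nat \<Rightarrow> 'a"
      show "?Q a e" using spec[OF *, of "a ## e"] by simp
    qed
  qed blast
  finally show ?thesis .
qed

section \<open>Completeness\<close>

instance trm :: countable by countable_datatype
instance fm :: countable by countable_datatype

lemma prv_taut1: "prv T a \<Longrightarrow> (\<And>v. pval v a \<Longrightarrow> pval v b) \<Longrightarrow> prv T b"
  by (rule prv.mp[OF prv.taut]) auto

lemma prv_taut2:
  assumes "prv T a" "prv T b" "\<And>v. pval v a \<Longrightarrow> pval v b \<Longrightarrow> pval v c"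
  shows "prv T c"
proof -
  have "prv T (FImp a (FImp b c))" by (rule prv.taut) (use assms(3) in auto)
  then show ?thesis using assms(1,2) prv.mp by blast
qed

lemma pval_rename: "pval v (rename_fm f p) = pval (\<lambda>q. v (rename_fm f q)) p"
  by (induction p) auto

lemma prv_rename:
  assumes T: "\<And>p. p \<in> T \<Longrightarrow> fv_fm p = {}" and "prv T p"
  shows "prv T (rename_fm f p)"
  using assms(2)
proof (induction arbitrary: f)
  case (ax p)
  have "rename_fm f p = rename_fm (\<lambda>i. i) p"
    by (rule rename_fm_cong) (simp add: T[OF ax])
  then show ?case using ax by (simp add: prv.ax)
next
  case (taut p)
  then show ?case by (intro prv.taut) (simp add: pval_rename)
next
  case (mp p q)
  then show ?case by (metis prv.mp rename_fm.simps(6))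
next
  case (gen q p)
  then show ?case using prv.gen[of T "rename_fm f q"] by (simp flip: rename_shiftr_lift_fm)
qed (simp_all add: rename_subst_fm prv.all_inst prv.ex_def1 prv.ex_def2 prv.eq_refl prv.eq_subst)

text \<open>The rule \<open>gen\<close> only accepts a lifted antecedent. The renaming that sends i
  to 0 and moves all other variables up by one turns c into its lift and the instance back into q,
  because i occurs in neither.\<close>

lemma prv_generalize:
  assumes T: "\<And>p. p \<in> T \<Longrightarrow> fv_fm p = {}"
    and prv: "prv T (FImp c (subst_fm 0 (TVar i) q))" and i: "i \<notin> fv_fm c" "Suc i \<notin> fv_fm q"
  shows "prv T (FImp c (FAll q))"
proof -
  let ?f = "\<lambda>j. if j = i then 0 else Suc j"
  have 1: "rename_fm ?f c = lift_fm 0 c"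
    unfolding lift_fm_rename by (rule rename_fm_cong) (use i in auto)
  have "rename_fm ?f (subst_fm 0 (TVar i) q) = rename_fm (\<lambda>j. j) q"
    unfolding subst_fm_var rename_fm_comp by (rule rename_fm_cong) (use i in \<open>auto simp: Suc_diff_le\<close>)
  then have 2: "rename_fm ?f (subst_fm 0 (TVar i) q) = q" by simp
  have "prv T (FImp (lift_fm 0 c) q)"
    using prv_rename[OF T prv, of ?f] by (simp only: rename_fm.simps 1 2)
  then show ?thesis by (rule prv.gen)
qed

section \<open>Henkin construction: each stage is a single formula\<close>

definition consis :: "fm set \<Rightarrow> fm \<Rightarrow> bool" where
  "consis T c \<longleftrightarrow> \<not> prv T (FNeg c)"

text \<open>A stage of the construction is one formula, so it has finitely many free variables and a
  fresh one always exists. The successor accounts for q standing under a binder.\<close>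

definition fresh :: "fm \<Rightarrow> fm \<Rightarrow> nat" where
  "fresh c q = (SOME i. i \<notin> fv_fm c \<and> Suc i \<notin> fv_fm q)"

lemma fresh: "fresh c q \<notin> fv_fm c" "Suc (fresh c q) \<notin> fv_fm q"
proof -
  have "finite (fv_fm c \<union> {i. Suc i \<in> fv_fm q})"
    using finite_fv_fm finite_vimageI[of "fv_fm q" Suc] by (simp add: vimage_def)
  then obtain i where "i \<notin> fv_fm c \<union> {i. Suc i \<in> fv_fm q}"
    using ex_new_if_finite[OF infinite_UNIV_nat] by blast
  then have "\<exists>i. i \<notin> fv_fm c \<and> Suc i \<notin> fv_fm q" by blast
  from someI_ex[OF this] show "fresh c q \<notin> fv_fm c" "Suc (fresh c q) \<notin> fv_fm q"
    by (simp_all add: fresh_def)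
qed

text \<open>Free variables play the role of Henkin constants.\<close>

definition henkin_step :: "fm set \<Rightarrow> fm \<Rightarrow> fm \<Rightarrow> fm" where
  "henkin_step T c p = (if consis T (FAnd c p) then FAnd c p else
     FAnd c (case p of FAll q \<Rightarrow> FAnd (FNeg p) (FNeg (subst_fm 0 (TVar (fresh c q)) q)) | _ \<Rightarrow> FNeg p))"

lemma henkin_step_cases:
  obtains "consis T (FAnd c p)" "henkin_step T c p = FAnd c p"
  | q where "\<not> consis T (FAnd c p)" "p = FAll q"
      "henkin_step T c p = FAnd c (FAnd (FNeg p) (FNeg (subst_fm 0 (TVar (fresh c q)) q)))"
  | "\<not> consis T (FAnd c p)" "\<forall>q. p \<noteq> FAll q" "henkin_step T c p = FAnd c (FNeg p)"
  by (cases "consis T (FAnd c p)"; cases p) (auto simp: henkin_step_def)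

text \<open>The critical case adds a negated universal formula with a counterexample variable. If
  that were refutable, c would prove the instance at a fresh variable, hence the universal formula
  itself, which was already found inconsistent with c.\<close>

lemma consis_henkin_step:
  assumes T: "\<And>p. p \<in> T \<Longrightarrow> fv_fm p = {}" and "consis T c"
  shows "consis T (henkin_step T c p)"
proof (cases T c p rule: henkin_step_cases)
  case (2 q)
  then have 1: "prv T (FNeg (FAnd c p))" by (simp add: consis_def)
  show ?thesis unfolding consis_def
  proof
    assume "prv T (FNeg (henkin_step T c p))"
    with 1 have "prv T (FImp c (subst_fm 0 (TVar (fresh c q)) q))"
      unfolding 2(3) by (rule prv_taut2) auto
    from prv_generalize[OF T this fresh] have "prv T (FImp c p)" unfolding 2(2) .
    with 1 have "prv T (FNeg c)" by (rule prv_taut2) auto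
    then show False using assms(2) by (simp add: consis_def)
  qed
next
  case 3
  then have 1: "prv T (FNeg (FAnd c p))" by (simp add: consis_def)
  show ?thesis unfolding consis_def
  proof
    assume "prv T (FNeg (henkin_step T c p))"
    with 1 have "prv T (FNeg c)" unfolding 3(3) by (rule prv_taut2) auto
    then show False using assms(2) by (simp add: consis_def)
  qed
qed simp

lemma henkin_step_imp: "prv T (FImp (henkin_step T c p) c)"
  by (cases T c p rule: henkin_step_cases) (auto intro!: prv.taut)

lemma henkin_step_decides:
  "prv T (FImp (henkin_step T c p) p) \<or> prv T (FImp (henkin_step T c p) (FNeg p))"
  by (cases T c p rule: henkin_step_cases) (auto intro!: prv.taut)

lemma henkin_step_witness:
  "prv T (FImp (henkin_step T c (FAll q)) (FAll q)) \<or>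
   (\<exists>t. prv T (FImp (henkin_step T c (FAll q)) (FNeg (subst_fm 0 t q))))"
proof (cases T c "FAll q" rule: henkin_step_cases)
  case 1
  then show ?thesis by (intro disjI1 prv.taut) auto
next
  case (2 r)
  then have "prv T (FImp (henkin_step T c (FAll q)) (FNeg (subst_fm 0 (TVar (fresh c q)) q)))"
    by (intro prv.taut) auto
  then show ?thesis by blast
qed blast

primrec henkin_chain :: "fm set \<Rightarrow> fm \<Rightarrow> nat \<Rightarrow> fm" where
  "henkin_chain T c 0 = c"
| "henkin_chain T c (Suc n) = henkin_step T (henkin_chain T c n) (from_nat n)"

lemma henkin_chain_mono: "n \<le> m \<Longrightarrow> prv T (FImp (henkin_chain T c m) (henkin_chain T c n))"
proof (induction m rule: dec_induct)
  case base
  show ?case by (rule prv.taut) simp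
next
  case (step m)
  from henkin_step_imp step.IH show ?case by (rule prv_taut2) auto
qed

section \<open>The term model of a Henkin set\<close>

locale henkin_set =
  fixes T :: "fm set" and G :: "fm set"
  assumes prv_in: "prv T p \<Longrightarrow> p \<in> G"
    and mp_in: "FImp p q \<in> G \<Longrightarrow> p \<in> G \<Longrightarrow> q \<in> G"
    and neg_in: "FNeg p \<in> G \<longleftrightarrow> p \<notin> G"
    and all_witness: "(\<And>t. subst_fm 0 t q \<in> G) \<Longrightarrow> FAll q \<in> G"

lemma henkin_set_exists:
  assumes T: "\<And>p. p \<in> T \<Longrightarrow> fv_fm p = {}" and "\<not> prv T p"
  obtains G where "henkin_set T G" "p \<notin> G"
proof -
  let ?c = "henkin_chain T (FNeg p)"
  define G where "G = {q. \<exists>n. prv T (FImp (?c n) q)}"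
  have "consis T (?c n)" for n
  proof (induction n)
    case 0
    show ?case unfolding consis_def
    proof
      assume "prv T (FNeg (?c 0))"
      then have "prv T p" by (rule prv_taut1) simp
      then show False using assms(2) by simp
    qed
  qed (simp add: consis_henkin_step T)
  then have cons: "\<not> prv T (FNeg (?c n))" for n by (simp add: consis_def)
  have up: "prv T (FImp (?c m) q)" if "prv T (FImp (?c n) q)" "n \<le> m" for n m q
    using henkin_chain_mono[OF that(2)] that(1) by (rule prv_taut2) auto
  \<comment> \<open>Two members of G are consequences of possibly different stages; the later stage
    implies both.\<close>
  have two: "r \<in> G" if "q \<in> G" "q' \<in> G" "\<And>v. pval v q \<Longrightarrow> pval v q' \<Longrightarrow> pval v r" for q q' r
  proof -
    from that obtain n m where *: "prv T (FImp (?c n) q)" "prv T (FImp (?c m) q')" by (auto simp: G_def)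
    have "prv T (FImp (?c (max n m)) q)" "prv T (FImp (?c (max n m)) q')"
      by (rule up[OF *(1)], simp, rule up[OF *(2)], simp)
    then have "prv T (FImp (?c (max n m)) r)" by (rule prv_taut2) (use that(3) in auto)
    then show ?thesis by (auto simp: G_def)
  qed
  have incons: False if q: "q \<in> G" "FNeg q \<in> G" for q
  proof -
    have "FNeg (FImp q q) \<in> G" by (rule two[OF q]) simp
    then obtain n where "prv T (FImp (?c n) (FNeg (FImp q q)))" by (auto simp: G_def)
    then have "prv T (FNeg (?c n))" by (rule prv_taut1) simp
    then show False using cons by simp
  qed
  \<comment> \<open>The formula q is treated at the stage with number
    \<open>to_nat q\<close>.\<close>
  have decide: "q \<in> G \<or> FNeg q \<in> G" for q
    using henkin_step_decides[of T "?c (to_nat q)" q]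
    unfolding G_def mem_Collect_eq by (metis from_nat_to_nat henkin_chain.simps(2))
  have "henkin_set T G"
  proof
    fix q assume "prv T q"
    then have "prv T (FImp (?c 0) q)" by (rule prv_taut1) simp
    then show "q \<in> G" unfolding G_def by blast
  next
    fix q r assume "FImp q r \<in> G" "q \<in> G"
    then show "r \<in> G" by (rule two) simp
  next
    fix q show "FNeg q \<in> G \<longleftrightarrow> q \<notin> G" using incons decide by blast
  next
    fix q assume *: "\<And>t. subst_fm 0 t q \<in> G"
    have "FAll q \<in> G \<or> (\<exists>t. FNeg (subst_fm 0 t q) \<in> G)"
      using henkin_step_witness[of T "?c (to_nat (FAll q))" q]
      unfolding G_def mem_Collect_eq by (metis from_nat_to_nat henkin_chain.simps(2))
    then show "FAll q \<in> G" using * incons by blast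
  qed
  moreover have "FNeg p \<in> G"
    unfolding G_def by (auto intro!: exI[of _ 0] prv.taut)
  then have "p \<notin> G" using incons by blast
  ultimately show ?thesis using that by blast
qed

context henkin_set
begin

lemma taut_in: "(\<And>v. pval v p) \<Longrightarrow> p \<in> G"
  by (rule prv_in) (auto intro: prv.taut)

lemma imp_in: "FImp p q \<in> G \<longleftrightarrow> (p \<in> G \<longrightarrow> q \<in> G)"
proof -
  have "FImp q (FImp p q) \<in> G" "FImp (FNeg p) (FImp p q) \<in> G" by (auto intro: taut_in)
  then show ?thesis using mp_in neg_in by blast
qed

lemma and_in: "FAnd p q \<in> G \<longleftrightarrow> p \<in> G \<and> q \<in> G"
proof -
  have "FImp (FAnd p q) p \<in> G" "FImp (FAnd p q) q \<in> G" "FImp p (FImp q (FAnd p q)) \<in> G"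
    by (auto intro: taut_in)
  then show ?thesis unfolding imp_in by blast
qed

lemma or_in: "FOr p q \<in> G \<longleftrightarrow> p \<in> G \<or> q \<in> G"
proof -
  have "FImp (FOr p q) (FImp (FNeg p) q) \<in> G" "FImp p (FOr p q) \<in> G" "FImp q (FOr p q) \<in> G"
    by (auto intro: taut_in)
  then show ?thesis unfolding imp_in neg_in by blast
qed

lemma all_in: "FAll q \<in> G \<longleftrightarrow> (\<forall>t. subst_fm 0 t q \<in> G)"
  using all_witness mp_in prv_in[OF prv.all_inst] by blast

text \<open>The construction supplies witnesses only against universal formulas; existential ones
  are reduced to them by the axioms \<open>ex_def1\<close> and \<open>ex_def2\<close>.\<close>

lemma ex_in: "FEx q \<in> G \<longleftrightarrow> (\<exists>t. subst_fm 0 t q \<in> G)"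
proof -
  have "FEx q \<in> G \<longleftrightarrow> FNeg (FAll (FNeg q)) \<in> G"
    using mp_in prv_in[OF prv.ex_def1] prv_in[OF prv.ex_def2] by blast
  then show ?thesis by (simp add: neg_in all_in)
qed

definition teq :: "trm \<Rightarrow> trm \<Rightarrow> bool" where
  "teq s t \<longleftrightarrow> FEq s t \<in> G"

text \<open>All congruence properties below come from this by a template p in which variable 0 marks
  the place to be replaced and the lifted terms are left alone by the substitution.\<close>

lemma leibniz: "teq s t \<Longrightarrow> subst_fm 0 s p \<in> G \<Longrightarrow> subst_fm 0 t p \<in> G"
  using prv_in[OF prv.eq_subst, of s t p] by (simp add: teq_def imp_in)

lemma teq_refl: "teq t t"
  using prv_in[OF prv.eq_refl] by (simp add: teq_def)

lemma teq_sym: "teq s t \<Longrightarrow> teq t s"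
  using leibniz[of s t "FEq (TVar 0) (lift_tm 0 s)"] teq_refl by (simp add: teq_def)

lemma teq_trans: "teq s t \<Longrightarrow> teq t u \<Longrightarrow> teq s u"
  using leibniz[of t u "FEq (lift_tm 0 s) (TVar 0)"] by (simp add: teq_def)

lemma teq_plus:
  assumes "teq s s'" "teq t t'" shows "teq (TPlus s t) (TPlus s' t')"
proof -
  have "teq (TPlus s t) (TPlus s' t)"
    using leibniz[OF assms(1), of "FEq (TPlus (lift_tm 0 s) (lift_tm 0 t)) (TPlus (TVar 0) (lift_tm 0 t))"]
      teq_refl by (simp add: teq_def)
  moreover have "teq (TPlus s' t) (TPlus s' t')"
    using leibniz[OF assms(2), of "FEq (TPlus (lift_tm 0 s') (lift_tm 0 t)) (TPlus (lift_tm 0 s') (TVar 0))"]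
      teq_refl by (simp add: teq_def)
  ultimately show ?thesis by (rule teq_trans)
qed

lemma teq_times:
  assumes "teq s s'" "teq t t'" shows "teq (TTimes s t) (TTimes s' t')"
proof -
  have "teq (TTimes s t) (TTimes s' t)"
    using leibniz[OF assms(1), of "FEq (TTimes (lift_tm 0 s) (lift_tm 0 t)) (TTimes (TVar 0) (lift_tm 0 t))"]
      teq_refl by (simp add: teq_def)
  moreover have "teq (TTimes s' t) (TTimes s' t')"
    using leibniz[OF assms(2), of "FEq (TTimes (lift_tm 0 s') (lift_tm 0 t)) (TTimes (lift_tm 0 s') (TVar 0))"]
      teq_refl by (simp add: teq_def)
  ultimately show ?thesis by (rule teq_trans)
qed

lemma lt_cong:
  assumes "teq s s'" "teq t t'" "FLt s t \<in> G" shows "FLt s' t' \<in> G"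
proof -
  have "FLt s' t \<in> G" using leibniz[OF assms(1), of "FLt (TVar 0) (lift_tm 0 t)"] assms(3) by simp
  then show ?thesis using leibniz[OF assms(2), of "FLt (lift_tm 0 s') (TVar 0)"] by simp
qed

text \<open>The term model is infinite by the order axioms, so its classes can be numbered by
  all of nat; no carrier set is needed.\<close>

definition term_class :: "trm \<Rightarrow> trm set" where
  "term_class t = {s. teq s t}"

lemma term_class_eq: "term_class s = term_class t \<longleftrightarrow> teq s t"
  unfolding term_class_def using teq_refl teq_sym teq_trans by blast

definition term_code :: "trm \<Rightarrow> nat" where
  "term_code t = to_nat_on (range term_class) (term_class t)"

definition code_term :: "nat \<Rightarrow> trm" where
  "code_term n = (SOME t. term_code t = n)"

definition term_str :: "nat str" where
  "term_str = \<lparr> str_zero = term_code TZero, str_one = term_code TOne,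
     str_plus = (\<lambda>a b. term_code (TPlus (code_term a) (code_term b))),
     str_times = (\<lambda>a b. term_code (TTimes (code_term a) (code_term b))),
     str_less = (\<lambda>a b. FLt (code_term a) (code_term b) \<in> G) \<rparr>"

lemma term_code_eq: "term_code s = term_code t \<longleftrightarrow> teq s t"
  unfolding term_code_def by (simp flip: term_class_eq)

lemma teq_code_term: "teq (code_term (term_code t)) t"
proof -
  have "\<exists>s. term_code s = term_code t" by blast
  from someI_ex[OF this] show ?thesis by (simp add: code_term_def flip: term_code_eq)
qed

lemma tval_term_str: "tval term_str (\<lambda>i. term_code (TVar i)) t = term_code t"
proof (induction t)
  case (TPlus s t)
  then show ?case by (simp add: term_str_def term_code_eq teq_plus teq_code_term)
next
  case (TTimes s t)
  then show ?case by (simp add: term_str_def term_code_eq teq_times teq_code_term)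
qed (simp_all add: term_str_def)

text \<open>Induction is on size because the quantifier cases pass to an instance, which is not a
  subformula. Surjectivity lets a quantifier over nat range over codes of terms.\<close>

lemma truth:
  assumes surj: "surj term_code"
  shows "sat term_str (\<lambda>i. term_code (TVar i)) p \<longleftrightarrow> p \<in> G"
proof (induction p rule: measure_induct_rule[of size])
  case (less p)
  let ?e = "\<lambda>i. term_code (TVar i)"
  have ran: "(\<forall>x. P x) = (\<forall>t. P (term_code t))" "(\<exists>x. P x) = (\<exists>t. P (term_code t))" for P
    using surj unfolding surj_def by metis+
  have sub: "sat term_str (term_code t ## ?e) q \<longleftrightarrow> subst_fm 0 t q \<in> G" if "size q < size p" for t q
    using less[of "subst_fm 0 t q"] that by (simp add: sat_subst tval_term_str)
  show ?case
  proof (cases p)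
    case (FEq s t)
    then show ?thesis by (simp add: tval_term_str term_code_eq teq_def)
  next
    case (FLt s t)
    have "FLt (code_term (term_code s)) (code_term (term_code t)) \<in> G \<longleftrightarrow> FLt s t \<in> G"
      using lt_cong teq_code_term teq_sym by blast
    then show ?thesis using FLt by (simp add: tval_term_str) (simp add: term_str_def)
  next
    case (FAll q)
    then show ?thesis using sub by (simp add: ran(1) all_in)
  next
    case (FEx q)
    then show ?thesis using sub by (simp add: ran(2) ex_in)
  qed (simp_all add: less neg_in and_in or_in imp_in)
qed

end

text \<open>\<open>TOne\<close> stands on the left since the order axiom adds a common right
  summand: 0 < 1 yields 0 + n < 1 + n directly.\<close>

primrec num :: "nat \<Rightarrow> trm" where
  "num 0 = TZero"
| "num (Suc n) = TPlus TOne (num n)"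

lemma subst_lift_tm_1 [simp]:
  "subst_tm (Suc 0) (lift_tm 0 s) (lift_tm 0 t) = lift_tm 0 (subst_tm 0 s t)"
  by (induction t) auto

text \<open>The numerals are strictly increasing in the term model, hence pairwise inequivalent.
  With infinitely many classes, the canonical enumeration is a bijection onto nat.\<close>

lemma (in henkin_set) surj_term_code:
  assumes "PAminus \<subseteq> T"
  shows "surj term_code"
proof -
  have ax: "close p \<in> G" if "close p \<in> PAminus" for p
    using that assms by (blast intro: prv_in prv.ax)
  have inst3: "subst_fm 0 t (subst_fm 1 (lift_tm 0 s) (subst_fm 2 (lift_tm 0 (lift_tm 0 r)) p)) \<in> G"
    if "FAll (FAll (FAll p)) \<in> G" for p r s t
    using that unfolding all_in by (simp add: all_in numeral_2_eq_2)
  have s2: "{0, 1, 2::nat} - {0} = {1, 2}" "{1, 2::nat} - {0} = {1, 2}" by auto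
  have FAll3: "FAll (FAll (FAll p)) \<in> G" if "close p \<in> PAminus" "fv_fm p = {0, 1, 2}" for p
    using ax[OF that(1)] that(2) by (simp add: close_def numeral_3_eq_3)
  have FAll2: "FAll (FAll p) \<in> G" if "close p \<in> PAminus" "fv_fm p = {0, 1}" for p
    using ax[OF that(1)] that(2) by (simp add: close_def)
  have FAll1: "FAll p \<in> G" if "close p \<in> PAminus" "fv_fm p = {0}" for p
    using ax[OF that(1)] that(2) by (simp add: close_def)
  have trans: "FLt r t \<in> G" if "FLt r s \<in> G" "FLt s t \<in> G" for r s t
  proof -
    have "FAll (FAll (FAll (FImp (FAnd (FLt vx vy) (FLt vy vz)) (FLt vx vz)))) \<in> G"
      by (rule FAll3) (auto simp: PAminus_def)
    from inst3[OF this, of r s t] show ?thesis using that by (simp add: imp_in and_in)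
  qed
  have irrefl: "FLt t t \<notin> G" for t
  proof -
    have "FAll (FNeg (FLt vx vx)) \<in> G"
      by (rule FAll1) (auto simp: PAminus_def)
    then show ?thesis by (simp add: all_in neg_in)
  qed
  have mono: "FLt (TPlus r t) (TPlus s t) \<in> G" if "FLt r s \<in> G" for r s t
  proof -
    have "FAll (FAll (FAll (FImp (FLt vx vy) (FLt (TPlus vx vz) (TPlus vy vz))))) \<in> G"
      by (rule FAll3) (auto simp: PAminus_def)
    from inst3[OF this, of r s t] show ?thesis using that by (simp add: imp_in)
  qed
  have comm: "teq (TPlus s t) (TPlus t s)" for s t
  proof -
    have "FAll (FAll (FEq (TPlus vx vy) (TPlus vy vx))) \<in> G"
      by (rule FAll2) (auto simp: PAminus_def)
    then have "subst_fm 0 s (subst_fm 1 (lift_tm 0 t) (FEq (TPlus vx vy) (TPlus vy vx))) \<in> G"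
      by (simp add: all_in)
    then show ?thesis by (simp add: teq_def)
  qed
  have zero: "teq (TPlus t TZero) t" for t
  proof -
    have "FAll (FAnd (FEq (TPlus vx TZero) vx) (FEq (TTimes vx TZero) TZero)) \<in> G"
      by (rule FAll1) (auto simp: PAminus_def)
    then show ?thesis by (simp add: all_in and_in teq_def)
  qed
  have one: "FLt TZero TOne \<in> G"
  proof -
    have "FAll (FAnd (FLt TZero TOne) (FImp (FLt TZero vx) (FOr (FLt TOne vx) (FEq TOne vx)))) \<in> G"
      by (rule FAll1) (auto simp: PAminus_def)
    then show ?thesis by (simp add: all_in and_in)
  qed
  have Suc: "FLt (num n) (num (Suc n)) \<in> G" for n
    using lt_cong[OF teq_trans[OF comm zero] teq_refl mono[OF one], of "num n"] by simp
  have less: "FLt (num n) (num m) \<in> G" if "n < m" for n m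
    using that by (rule less_Suc_induct) (rule Suc, rule trans)
  have "inj (term_class \<circ> num)"
  proof (rule injI)
    fix n m assume "(term_class \<circ> num) n = (term_class \<circ> num) m"
    then have "teq (num n) (num m)" by (simp add: term_class_eq)
    then have "FLt (num n) (num m) \<notin> G" "FLt (num m) (num n) \<notin> G"
      using lt_cong[OF _ teq_refl] teq_sym irrefl by metis+
    then have "\<not> n < m" "\<not> m < n" using less by metis+
    then show "n = m" by simp
  qed
  then have "infinite (range (term_class \<circ> num))"
    using range_inj_infinite by blast
  then have "infinite (range term_class)"
    by (rule contrapos_nn) (auto elim: finite_subset[rotated])
  then have "bij_betw (to_nat_on (range term_class)) (range term_class) UNIV"
    by (intro to_nat_on_infinite) auto
  then have "to_nat_on (range term_class) ` range term_class = UNIV" by (rule bij_betw_imp_surj_on)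
  then show ?thesis by (simp add: term_code_def image_image)
qed

theorem completeness:
  assumes T: "\<And>p. p \<in> T \<Longrightarrow> fv_fm p = {}" and "PAminus \<subseteq> T"
    and "fv_fm p = {}"
    and valid: "\<And>(M :: nat str) e. (\<And>q. q \<in> T \<Longrightarrow> sat M e q) \<Longrightarrow> sat M e p"
  shows "prv T p"
proof (rule ccontr)
  assume "\<not> prv T p"
  then obtain G where "henkin_set T G" "p \<notin> G" using henkin_set_exists T by blast
  then interpret henkin_set T G by simp
  note truth = truth[OF surj_term_code[OF assms(2)]]
  have "sat term_str (\<lambda>i. term_code (TVar i)) p"
    by (rule valid) (simp add: truth prv_in prv.ax)
  then show False using truth \<open>p \<notin> G\<close> by simp
qed

section \<open>Arithmetic in a model\<close>

locale pa_model =
  fixes M :: "'d str"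
  assumes sat_PAminus: "p \<in> PAminus \<Longrightarrow> sat M e p"
begin

abbreviation zer ("\<zero>") where "\<zero> \<equiv> str_zero M"
abbreviation uno ("\<one>") where "\<one> \<equiv> str_one M"
abbreviation add (infixl "\<oplus>" 65) where "x \<oplus> y \<equiv> str_plus M x y"
abbreviation mul (infixl "\<otimes>" 70) where "x \<otimes> y \<equiv> str_times M x y"
abbreviation lt (infix "\<prec>" 50) where "x \<prec> y \<equiv> str_less M x y"
definition le (infix "\<preceq>" 50) where "x \<preceq> y \<longleftrightarrow> x \<prec> y \<or> x = y"
text \<open>Truncated subtraction is not in the language. It is introduced so that the model becomes
  a \<open>linordered_semidom\<close>, which brings the library on order and divisibility, in
  particular cancellation of a divisible summand.\<close>

definition monus (infixl "\<ominus>" 65) where "x \<ominus> y = (if y \<preceq> x then THE z. y \<oplus> z = x else \<zero>)"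

lemma PA:
  shows add_assoc: "x \<oplus> y \<oplus> z = x \<oplus> (y \<oplus> z)"
    and add_comm: "x \<oplus> y = y \<oplus> x"
    and mul_assoc: "x \<otimes> y \<otimes> z = x \<otimes> (y \<otimes> z)"
    and mul_comm: "x \<otimes> y = y \<otimes> x"
    and mul_add_distrib: "x \<otimes> (y \<oplus> z) = x \<otimes> y \<oplus> x \<otimes> z"
    and add_zero: "x \<oplus> \<zero> = x" and mul_zero: "x \<otimes> \<zero> = \<zero>"
    and mul_one: "x \<otimes> \<one> = x"
    and lt_trans: "x \<prec> y \<Longrightarrow> y \<prec> z \<Longrightarrow> x \<prec> z"
    and lt_irrefl: "\<not> x \<prec> x"
    and lt_linear: "x \<prec> y \<or> x = y \<or> y \<prec> x"
    and lt_add_mono: "x \<prec> y \<Longrightarrow> x \<oplus> z \<prec> y \<oplus> z"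
    and mul_mono: "\<zero> \<prec> z \<Longrightarrow> x \<prec> y \<Longrightarrow> x \<otimes> z \<prec> y \<otimes> z"
    and lt_ex_add: "x \<prec> y \<Longrightarrow> \<exists>z. x \<oplus> z = y"
    and zero_lt_one: "\<zero> \<prec> \<one>"
    and discrete: "\<zero> \<prec> x \<Longrightarrow> \<one> \<prec> x \<or> \<one> = x"
    and zero_min: "\<zero> \<prec> x \<or> \<zero> = x"
proof -
  have *: "sat M (x ## y ## z ## undefined) p" if "close p \<in> PAminus" for p
    using sat_PAminus[OF that] unfolding sat_close by blast
  note ax = *[unfolded PAminus_def, OF imageI]
  show "x \<oplus> y \<oplus> z = x \<oplus> (y \<oplus> z)"
    using ax[of "FEq (TPlus (TPlus vx vy) vz) (TPlus vx (TPlus vy vz))"] by simp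
  show "x \<oplus> y = y \<oplus> x"
    using ax[of "FEq (TPlus vx vy) (TPlus vy vx)"] by simp
  show "x \<otimes> y \<otimes> z = x \<otimes> (y \<otimes> z)"
    using ax[of "FEq (TTimes (TTimes vx vy) vz) (TTimes vx (TTimes vy vz))"] by simp
  show "x \<otimes> y = y \<otimes> x"
    using ax[of "FEq (TTimes vx vy) (TTimes vy vx)"] by simp
  show "x \<otimes> (y \<oplus> z) = x \<otimes> y \<oplus> x \<otimes> z"
    using ax[of "FEq (TTimes vx (TPlus vy vz)) (TPlus (TTimes vx vy) (TTimes vx vz))"] by simp
  show "x \<oplus> \<zero> = x" "x \<otimes> \<zero> = \<zero>"
    using ax[of "FAnd (FEq (TPlus vx TZero) vx) (FEq (TTimes vx TZero) TZero)"] by simp_all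
  show "x \<otimes> \<one> = x"
    using ax[of "FEq (TTimes vx TOne) vx"] by simp
  show "x \<prec> y \<Longrightarrow> y \<prec> z \<Longrightarrow> x \<prec> z"
    using ax[of "FImp (FAnd (FLt vx vy) (FLt vy vz)) (FLt vx vz)"] by simp
  show "\<not> x \<prec> x"
    using ax[of "FNeg (FLt vx vx)"] by simp
  show "x \<prec> y \<or> x = y \<or> y \<prec> x"
    using ax[of "FOr (FLt vx vy) (FOr (FEq vx vy) (FLt vy vx))"] by simp
  show "x \<prec> y \<Longrightarrow> x \<oplus> z \<prec> y \<oplus> z"
    using ax[of "FImp (FLt vx vy) (FLt (TPlus vx vz) (TPlus vy vz))"] by simp
  show "\<zero> \<prec> z \<Longrightarrow> x \<prec> y \<Longrightarrow> x \<otimes> z \<prec> y \<otimes> z"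
    using ax[of "FImp (FAnd (FLt TZero vz) (FLt vx vy)) (FLt (TTimes vx vz) (TTimes vy vz))"] by simp
  show "x \<prec> y \<Longrightarrow> \<exists>z. x \<oplus> z = y"
    using ax[of "FImp (FLt vx vy) (FEx (FEq (TPlus (TVar 1) (TVar 0)) (TVar 2)))"] by simp
  show "\<zero> \<prec> \<one>" "\<zero> \<prec> x \<Longrightarrow> \<one> \<prec> x \<or> \<one> = x"
    using ax[of "FAnd (FLt TZero TOne) (FImp (FLt TZero vx) (FOr (FLt TOne vx) (FEq TOne vx)))"] by simp_all
  show "\<zero> \<prec> x \<or> \<zero> = x"
    using ax[of "FOr (FLt TZero vx) (FEq TZero vx)"] by simp
qed

lemma add_cancel: "x \<oplus> y = x \<oplus> z \<longleftrightarrow> y = z"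
  using lt_linear[of y z] lt_add_mono[of y z x] lt_add_mono[of z y x] lt_irrefl by (metis add_comm)

lemma add_monus: "x \<oplus> y \<ominus> x = y"
proof -
  have "x \<preceq> x \<oplus> y"
    using zero_min[of y] lt_add_mono[of \<zero> y x] unfolding le_def by (metis add_comm add_zero)
  then show ?thesis by (simp add: monus_def add_cancel)
qed

lemma le_ex_add: "x \<preceq> y \<Longrightarrow> \<exists>z. y = x \<oplus> z"
  unfolding le_def using lt_ex_add add_zero by metis

lemma le_add: "x \<preceq> x \<oplus> y"
  using zero_min[of y] lt_add_mono[of \<zero> y x] unfolding le_def by (metis add_comm add_zero)

lemma monus_not_le: "\<not> y \<preceq> x \<Longrightarrow> x \<ominus> y = \<zero>"
  by (simp add: monus_def)

lemma mul_eq_zero: "x \<otimes> y = \<zero> \<Longrightarrow> x = \<zero> \<or> y = \<zero>"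
  using zero_min[of x] zero_min[of y] mul_mono[of y \<zero> x] lt_irrefl by (metis mul_comm mul_zero)

lemma le_add_cancel: "x \<oplus> y \<preceq> x \<oplus> z \<longleftrightarrow> y \<preceq> z"
  unfolding le_def by (metis add_comm add_cancel lt_add_mono lt_irrefl lt_linear lt_trans)

lemma monus_monus: "x \<ominus> y \<ominus> z = x \<ominus> (y \<oplus> z)"
proof (cases "y \<preceq> x")
  case True
  then obtain u where u: "x = y \<oplus> u" using le_ex_add by blast
  show ?thesis
  proof (cases "z \<preceq> u")
    case True
    then obtain v where "u = z \<oplus> v" using le_ex_add by blast
    then show ?thesis using add_monus[of "y \<oplus> z" v] by (simp add: u add_monus add_assoc)
  next
    case False
    then show ?thesis by (simp add: u add_monus monus_not_le le_add_cancel)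
  qed
next
  case False
  then have 1: "\<not> y \<oplus> z \<preceq> x"
    unfolding le_def by (metis le_add le_def lt_trans)
  have "\<zero> \<ominus> z = \<zero>"
    by (metis add_monus add_zero le_def lt_irrefl lt_trans monus_not_le zero_min)
  then show ?thesis using False 1 by (simp add: monus_not_le)
qed

lemma mul_monus: "x \<otimes> (y \<ominus> z) = x \<otimes> y \<ominus> x \<otimes> z"
proof (cases "z \<preceq> y")
  case True
  then obtain u where "y = z \<oplus> u" using le_ex_add by blast
  then show ?thesis by (simp add: add_monus mul_add_distrib)
next
  case False
  then have "y \<prec> z" using lt_linear unfolding le_def by blast
  have z0: "\<zero> \<ominus> \<zero> = \<zero>" using add_monus[of \<zero> \<zero>] by (simp add: add_zero)
  consider "x = \<zero>" | "\<zero> \<prec> x" using zero_min by blast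
  then show ?thesis
  proof cases
    case 1
    then show ?thesis using mul_comm[of \<zero>] by (simp add: mul_zero z0)
  next
    case 2
    then have "x \<otimes> y \<prec> x \<otimes> z" using mul_mono[OF _ \<open>y \<prec> z\<close>] mul_comm by simp
    then have "\<not> x \<otimes> z \<preceq> x \<otimes> y" unfolding le_def using lt_irrefl lt_trans by metis
    then show ?thesis using False by (simp add: monus_not_le mul_zero)
  qed
qed

sublocale sr: linordered_semidom
  where plus = "(\<oplus>)" and times = "(\<otimes>)" and zero = \<zero> and one = \<one>
    and minus = "(\<ominus>)" and less_eq = "(\<preceq>)" and less = "(\<prec>)"
proof (unfold_locales, goal_cases)
  case 1 show ?case by (rule add_assoc) next
  case 2 show ?case by (rule add_comm) next
  case 3 show ?case by (rule add_monus) next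
  case 4 show ?case by (rule monus_monus) next
  case 5 show ?case using lt_linear lt_irrefl lt_trans unfolding le_def by metis next
  case 6 show ?case by (simp add: le_def) next
  case 7 then show ?case using lt_trans unfolding le_def by metis next
  case 8 then show ?case using lt_irrefl lt_trans unfolding le_def by metis next
  case 9 then show ?case by (simp add: le_add_cancel) next
  case 10 show ?case using lt_linear unfolding le_def by metis next
  case 11 show ?case using add_zero add_comm by metis next
  case 12 show ?case by (rule mul_assoc) next
  case 13 show ?case by (rule mul_comm) next
  case 14 show ?case using mul_add_distrib mul_comm by metis next
  case 15 show ?case using mul_zero mul_comm by metis next
  case 16 show ?case by (rule mul_zero) next
  case 17 then show ?case using mul_mono mul_comm by metis next
  case 18 show ?case using mul_one mul_comm by metis next
  case 19 show ?case using zero_lt_one lt_irrefl by metis next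
  case 20 show ?case by (rule mul_monus) next
  case 21 show ?case by (rule mul_add_distrib) next
  case 22 then show ?case using mul_eq_zero by blast next
  case 23 show ?case by (rule zero_lt_one) next
  case 24 then show ?case using le_ex_add add_monus add_comm by metis
qed

lemma lt_succ: "x \<prec> y \<oplus> \<one> \<longleftrightarrow> x \<preceq> y"
proof
  assume "x \<prec> y \<oplus> \<one>"
  show "x \<preceq> y"
  proof (rule ccontr)
    assume "\<not> x \<preceq> y"
    then have "y \<prec> x" by (simp add: sr.not_le)
    then obtain z where z: "x = y \<oplus> z" "z \<noteq> \<zero>" using lt_ex_add add_zero lt_irrefl by metis
    then have "\<one> \<preceq> z" using zero_min discrete unfolding le_def by metis
    then have "y \<oplus> \<one> \<preceq> x" by (simp add: z le_add_cancel)
    then show False using \<open>x \<prec> y \<oplus> \<one>\<close> by (simp add: sr.not_le[symmetric])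
  qed
next
  assume "x \<preceq> y"
  moreover have "y \<prec> y \<oplus> \<one>" using lt_add_mono[OF zero_lt_one, of y] add_comm add_zero by metis
  ultimately show "x \<prec> y \<oplus> \<one>" by (rule sr.le_less_trans)
qed

lemma not_lt_zero: "\<not> x \<prec> \<zero>"
  using zero_min lt_irrefl lt_trans by metis

lemma zero_or_succ: "x = \<zero> \<or> (\<exists>y. x = y \<oplus> \<one>)"
  using zero_min[of x] discrete[of x] le_ex_add[of \<one> x] add_comm unfolding le_def by metis

end

section \<open>The arithmetical hierarchy\<close>

lemma delta0_rename: "delta0 p \<Longrightarrow> delta0 (rename_fm f p)"
proof (induction arbitrary: f rule: delta0.induct)
  case (7 p t)
  then show ?case by (simp add: rename_shiftr_lift_tm delta0.intros(7))
next
  case (8 p t)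
  then show ?case by (simp add: rename_shiftr_lift_tm delta0.intros(8))
qed (auto intro: delta0.intros)

lemma sigma_pi_rename:
  "(sigma k p \<longrightarrow> (\<forall>f. sigma k (rename_fm f p))) \<and> (pi k q \<longrightarrow> (\<forall>f. pi k (rename_fm f q)))"
proof (rule conjI; rule impI)
  have "sigma k p \<Longrightarrow> (\<forall>f. sigma k (rename_fm f p))" "pi k q \<Longrightarrow> (\<forall>f. pi k (rename_fm f q))" for k p q
    by (induction rule: sigma_pi.inducts) (auto intro: sigma_pi.intros delta0_rename)
  then show "sigma k p \<Longrightarrow> \<forall>f. sigma k (rename_fm f p)" "pi k q \<Longrightarrow> \<forall>f. pi k (rename_fm f q)" by auto
qed

lemmas sigma_rename = sigma_pi_rename[THEN conjunct1, rule_format]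
lemmas pi_rename = sigma_pi_rename[THEN conjunct2, rule_format]

lemma sigma_pi_Suc: "sigma k p \<Longrightarrow> sigma (Suc k) p" "pi k q \<Longrightarrow> pi (Suc k) q"
  by (induction rule: sigma_pi.inducts) (auto intro: sigma_pi.intros)

lemma sigma_mono: "sigma k p \<Longrightarrow> k \<le> l \<Longrightarrow> sigma l p"
  by (induction l) (auto simp: le_Suc_eq intro: sigma_pi_Suc)

lemma pi_mono: "pi k p \<Longrightarrow> k \<le> l \<Longrightarrow> pi l p"
  by (induction l) (auto simp: le_Suc_eq intro: sigma_pi_Suc)

text \<open>\<open>FNeg\<close> leads out of the prefix classes, so the negation is pushed through
  the prefix to the \<open>delta0\<close> matrix. The new formula is equivalent in all structures
  over the given type at once.\<close>

lemma sigma_pi_neg: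
  "sigma k p \<Longrightarrow> \<exists>q. pi k q \<and> (\<forall>(M :: 'd str) e. sat M e q = (\<not> sat M e p))"
  "pi k p' \<Longrightarrow> \<exists>q. sigma k q \<and> (\<forall>(M :: 'd str) e. sat M e q = (\<not> sat M e p'))"
proof (induction rule: sigma_pi.inducts)
  case (1 p)
  show ?case by (rule exI[of _ "FNeg p"]) (simp add: 1 sigma_pi.intros delta0.intros)
next
  case (2 p)
  show ?case by (rule exI[of _ "FNeg p"]) (simp add: 2 sigma_pi.intros delta0.intros)
next
  case (5 n p)
  then obtain q where "pi (Suc n) q" "\<forall>(M :: 'd str) e. sat M e q = (\<not> sat M e p)" by blast
  then show ?case by (intro exI[of _ "FAll q"]) (simp add: sigma_pi.intros)
next
  case (6 n p)
  then obtain q where "sigma (Suc n) q" "\<forall>(M :: 'd str) e. sat M e q = (\<not> sat M e p)" by blast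
  then show ?case by (intro exI[of _ "FEx q"]) (simp add: sigma_pi.intros)
qed (blast intro: sigma_pi.intros)+

lemma sigma_Suc_induct [consumes 1, case_names pi ex]:
  assumes "sigma (Suc k) p" "\<And>p. pi k p \<Longrightarrow> P p" "\<And>p. sigma (Suc k) p \<Longrightarrow> P p \<Longrightarrow> P (FEx p)"
  shows "P p"
proof -
  have "sigma n p \<Longrightarrow> n = Suc k \<Longrightarrow> P p" "pi n q \<Longrightarrow> True" for n q
    by (induction rule: sigma_pi.inducts) (use assms(2,3) in auto)
  then show ?thesis using assms(1) by blast
qed

text \<open>The flag c treats conjunction and disjunction together: the inductive step passes to the
  \<open>pi\<close> level by negation, which exchanges the two.\<close>

lemma sigma_and_or:
  "sigma k p \<Longrightarrow> sigma k q \<Longrightarrow>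
    \<exists>r. sigma k r \<and> (\<forall>(M :: 'd str) e. sat M e r = (if c then sat M e p \<and> sat M e q else sat M e p \<or> sat M e q))"
proof (induction k arbitrary: p q c)
  case 0
  then have "delta0 p" "delta0 q" by (auto elim: sigma.cases)
  then have "sigma 0 (if c then FAnd p q else FOr p q)" by (auto intro: sigma_pi.intros delta0.intros)
  then show ?case by (intro exI[of _ "if c then FAnd p q else FOr p q"]) auto
next
  case (Suc k)
  have both_pi: "\<exists>r. pi k r \<and> (\<forall>(M :: 'd str) e. sat M e r = (if c then sat M e p \<and> sat M e q else sat M e p \<or> sat M e q))"
    if pq: "pi k p" "pi k q" for p q
  proof -
    obtain p' q' where *: "sigma k p'" "\<forall>(M :: 'd str) e. sat M e p' = (\<not> sat M e p)"
      "sigma k q'" "\<forall>(M :: 'd str) e. sat M e q' = (\<not> sat M e q)"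
      using sigma_pi_neg(2)[OF pq(1)] sigma_pi_neg(2)[OF pq(2)] by blast
    from Suc.IH[OF *(1,3), of "\<not> c"] obtain r where r: "sigma k r"
      "\<forall>(M :: 'd str) e. sat M e r = (if \<not> c then sat M e p' \<and> sat M e q' else sat M e p' \<or> sat M e q')"
      by blast
    from sigma_pi_neg(1)[OF r(1)] obtain r' where "pi k r'" "\<forall>(M :: 'd str) e. sat M e r' = (\<not> sat M e r)"
      by blast
    then show ?thesis using * r by (intro exI[of _ r']) auto
  qed
  \<comment> \<open>Prenexing, one side at a time: the existential prefix of q is pulled out while p
    is renamed by \<open>Suc\<close> past each quantifier. The prefix of p follows in the same way
    afterwards.\<close>
  have 1: "\<exists>r. sigma (Suc k) r \<and> (\<forall>(M :: 'd str) e. sat M e r = (if c then sat M e p \<and> sat M e q else sat M e p \<or> sat M e q))"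
    if "pi k p" "sigma (Suc k) q" for p q
    using that(2,1)
  proof (induction arbitrary: p rule: sigma_Suc_induct)
    case (pi q)
    then show ?case using both_pi[of p q] sigma_pi.intros(3) by blast
  next
    case (ex q)
    from ex.IH[OF pi_rename[OF ex.prems]] obtain r where "sigma (Suc k) r"
      "\<forall>(M :: 'd str) e. sat M e r = (if c then sat M e (rename_fm Suc p) \<and> sat M e q else sat M e (rename_fm Suc p) \<or> sat M e q)"
      by blast
    then show ?case by (intro exI[of _ "FEx r"]) (auto simp: sat_rename comp_def intro: sigma_pi.intros)
  qed
  from Suc.prems show ?case
  proof (induction arbitrary: q rule: sigma_Suc_induct)
    case (pi p)
    then show ?case using 1 by blast
  next
    case (ex p)
    from ex.IH[OF sigma_rename[OF ex.prems]] obtain r where "sigma (Suc k) r"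
      "\<forall>(M :: 'd str) e. sat M e r = (if c then sat M e p \<and> sat M e (rename_fm Suc q) else sat M e p \<or> sat M e (rename_fm Suc q))"
      by blast
    then show ?case by (intro exI[of _ "FEx r"]) (auto simp: sat_rename comp_def intro: sigma_pi.intros)
  qed
qed

section \<open>Predicates definable with parameters\<close>

text \<open>A predicate on environments is definable if it is the satisfaction of a formula in an environment
  each of whose entries is either a constant (a parameter) or an entry of the given one.\<close>

definition simple :: "((nat \<Rightarrow> 'd) \<Rightarrow> 'd) \<Rightarrow> bool" where
  "simple u \<longleftrightarrow> (\<exists>c. u = (\<lambda>_. c)) \<or> (\<exists>j. u = (\<lambda>e. e j))"

definition simples :: "((nat \<Rightarrow> 'd) \<Rightarrow> nat \<Rightarrow> 'd) \<Rightarrow> bool" where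
  "simples \<tau> \<longleftrightarrow> (\<forall>i. simple (\<lambda>e. \<tau> e i))"

lemma simple_var [intro]: "simple (\<lambda>e. e j)"
  and simple_const [intro]: "simple (\<lambda>e. c)"
  by (auto simp: simple_def)

lemma simples_id: "simples (\<lambda>e. e)"
  and simples_const: "simples (\<lambda>e. e0)"
  and simples_rename: "simples (\<lambda>e i. e (f i))"
  by (auto simp: simples_def)

lemma simples_scons: "simple u \<Longrightarrow> simples \<tau> \<Longrightarrow> simples (\<lambda>e. u e ## \<tau> e)"
  unfolding simples_def
proof
  fix i assume "simple u" "\<forall>i. simple (\<lambda>e. \<tau> e i)"
  then show "simple (\<lambda>e. (u e ## \<tau> e) i)" by (cases i) auto
qed

lemmas simples_intros = simples_id simples_rename simples_const simples_scons simple_var simple_const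

lemma simples_comp:
  assumes "simples \<sigma>" "simples \<tau>" shows "simples (\<lambda>e. \<sigma> (\<tau> e))"
  unfolding simples_def
proof
  fix i
  consider c where "(\<lambda>e. \<sigma> e i) = (\<lambda>_. c)" | j where "(\<lambda>e. \<sigma> e i) = (\<lambda>e. e j)"
    using assms(1) unfolding simples_def simple_def by blast
  then show "simple (\<lambda>e. \<sigma> (\<tau> e) i)"
  proof cases
    case 1
    have "(\<lambda>e. \<sigma> (\<tau> e) i) = (\<lambda>_. c)" using fun_cong[OF 1] by auto
    then show ?thesis by auto
  next
    case 2
    have "(\<lambda>e. \<sigma> (\<tau> e) i) = (\<lambda>e. \<tau> e j)" using fun_cong[OF 2] by auto
    then show ?thesis using assms(2) by (auto simp: simples_def)
  qed
qed

definition rename_closed :: "(fm \<Rightarrow> bool) \<Rightarrow> bool" where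
  "rename_closed C \<longleftrightarrow> (\<forall>p f. C p \<longrightarrow> C (rename_fm f p))"

lemma rename_closed [simp]: "rename_closed delta0" "rename_closed (sigma k)" "rename_closed (pi k)"
  by (auto simp: rename_closed_def delta0_rename sigma_rename pi_rename)

definition defin :: "'d str \<Rightarrow> (fm \<Rightarrow> bool) \<Rightarrow> ((nat \<Rightarrow> 'd) \<Rightarrow> bool) \<Rightarrow> bool" where
  "defin M C P \<longleftrightarrow> (\<exists>p \<sigma>. C p \<and> simples \<sigma> \<and> P = (\<lambda>e. sat M (\<sigma> e) p))"

lemma defin_subst:
  assumes "defin M C P" "simples \<tau>" shows "defin M C (\<lambda>e. P (\<tau> e))"
proof -
  from assms(1) obtain p \<sigma> where *: "C p" "simples \<sigma>" "P = (\<lambda>e. sat M (\<sigma> e) p)"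
    unfolding defin_def by blast
  then have "(\<lambda>e. P (\<tau> e)) = (\<lambda>e. sat M (\<sigma> (\<tau> e)) p)" by simp
  then show ?thesis using * simples_comp[OF *(2) assms(2)] unfolding defin_def by blast
qed

lemma defin_rename1: "defin M C (\<lambda>e. P (e 0)) \<Longrightarrow> defin M C (\<lambda>e. P (e i))"
  using defin_subst[OF _ simples_rename[of "\<lambda>_. i"], of M C "\<lambda>e. P (e 0)"] by simp

lemma defin_rename2: "defin M C (\<lambda>e. P (e 0) (e 1)) \<Longrightarrow> defin M C (\<lambda>e. P (e i) (e j))"
  using defin_subst[OF _ simples_rename[of "\<lambda>n. if n = 0 then i else j"], of M C "\<lambda>e. P (e 0) (e 1)"]
  by simp

text \<open>Interleaving at even and odd indices gives two formulas one common environment, so that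
  they can be joined by a connective.\<close>

lemma simples_merge:
  assumes "simples \<sigma>" "simples \<tau>"
  obtains \<rho> where "simples \<rho>" "\<And>e. \<rho> e \<circ> (\<lambda>i. 2 * i) = \<sigma> e" "\<And>e. \<rho> e \<circ> (\<lambda>i. Suc (2 * i)) = \<tau> e"
proof
  let ?r = "\<lambda>e i. if even i then \<sigma> e (i div 2) else \<tau> e (i div 2)"
  have "simple (\<lambda>e. ?r e i)" for i
    using assms by (cases "even i") (simp_all add: simples_def)
  then show "simples ?r" by (simp add: simples_def)
  show "?r e \<circ> (\<lambda>i. 2 * i) = \<sigma> e" "?r e \<circ> (\<lambda>i. Suc (2 * i)) = \<tau> e" for e by auto
qed

lemma defin_pair:
  assumes "rename_closed C" "rename_closed D" "defin M C P" "defin M D Q"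
  obtains p q \<sigma> where "C p" "D q" "simples \<sigma>" "P = (\<lambda>e. sat M (\<sigma> e) p)" "Q = (\<lambda>e. sat M (\<sigma> e) q)"
proof -
  from assms(3) obtain p \<sigma> where p: "C p" "simples \<sigma>" "P = (\<lambda>e. sat M (\<sigma> e) p)"
    unfolding defin_def by blast
  from assms(4) obtain q \<tau> where q: "D q" "simples \<tau>" "Q = (\<lambda>e. sat M (\<tau> e) q)"
    unfolding defin_def by blast
  obtain \<rho> where r: "simples \<rho>" "\<And>e. \<rho> e \<circ> (\<lambda>i. 2 * i) = \<sigma> e" "\<And>e. \<rho> e \<circ> (\<lambda>i. Suc (2 * i)) = \<tau> e"
    using simples_merge[OF p(2) q(2)] by blast
  show ?thesis
  proof
    show "C (rename_fm (\<lambda>i. 2 * i) p)" "D (rename_fm (\<lambda>i. Suc (2 * i)) q)"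
      using assms(1,2) p(1) q(1) by (auto simp: rename_closed_def)
    show "P = (\<lambda>e. sat M (\<rho> e) (rename_fm (\<lambda>i. 2 * i) p))"
      "Q = (\<lambda>e. sat M (\<rho> e) (rename_fm (\<lambda>i. Suc (2 * i)) q))"
      by (simp_all add: p q sat_rename r(2,3))
  qed (fact r(1))
qed

text \<open>Before a quantifier can bind the head of the environment, all positions of \<sigma> that
  read the head must be gathered at index 0. The renaming f does this and moves every other position
  up; those positions ignore the head, so \<open>undefined\<close> may stand there.\<close>

lemma simples_scons_split:
  assumes "simples \<sigma>"
  obtains f \<tau> where "simples \<tau>" "\<And>x e. \<sigma> (x ## e) = (x ## \<tau> e) \<circ> f"
proof
  let ?f = "\<lambda>i. if (\<lambda>e. \<sigma> e i) = (\<lambda>e. e 0) then 0 else Suc i"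
  let ?t = "\<lambda>e i. if (\<lambda>e. \<sigma> e i) = (\<lambda>e. e 0) then e 0 else \<sigma> (undefined ## e) i"
  have *: "(\<lambda>e. \<sigma> e i) = (\<lambda>e. e 0) \<or> (\<exists>c. (\<lambda>e. \<sigma> e i) = (\<lambda>_. c)) \<or> (\<exists>j. (\<lambda>e. \<sigma> e i) = (\<lambda>e. e (Suc j)))" for i
    using assms unfolding simples_def simple_def by (metis not0_implies_Suc)
  show "simples ?t" unfolding simples_def
  proof
    fix i show "simple (\<lambda>e. ?t e i)"
    proof (cases "(\<lambda>e. \<sigma> e i) = (\<lambda>e. e 0)")
      case False
      with * consider c where "(\<lambda>e. \<sigma> e i) = (\<lambda>_. c)" | j where "(\<lambda>e. \<sigma> e i) = (\<lambda>e. e (Suc j))"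
        by metis
      then have "simple (\<lambda>e. \<sigma> (undefined ## e) i)"
      proof cases
        case (1 c)
        show ?thesis using fun_cong[OF 1] by auto
      next
        case (2 j)
        show ?thesis using fun_cong[OF 2] by auto
      qed
      then show ?thesis using False by simp
    qed auto
  qed
  show "\<sigma> (x ## e) = (x ## ?t e) \<circ> ?f" for x e
  proof
    fix i show "\<sigma> (x ## e) i = ((x ## ?t e) \<circ> ?f) i"
      using *[of i]
    proof (elim disjE exE)
      assume c: "(\<lambda>e. \<sigma> e i) = (\<lambda>e. e 0)"
      show ?thesis using fun_cong[OF c] c by simp
    next
      fix c assume c: "(\<lambda>e. \<sigma> e i) = (\<lambda>_. c)"
      show ?thesis
      \<comment> \<open>Being constant and reading the head are not exclusive: in a one-element
        universe both hold.\<close>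
      proof (cases "(\<lambda>e. \<sigma> e i) = (\<lambda>e. e 0)")
        case True
        then show ?thesis using fun_cong[OF True, of "x ## e"] by simp
      next
        case False
        then show ?thesis using fun_cong[OF c] by simp
      qed
    next
      fix j assume j: "(\<lambda>e. \<sigma> e i) = (\<lambda>e. e (Suc j))"
      show ?thesis
      proof (cases "(\<lambda>e. \<sigma> e i) = (\<lambda>e. e 0)")
        case True
        then show ?thesis using fun_cong[OF True, of "x ## e"] by simp
      next
        case False
        then show ?thesis using fun_cong[OF j] by simp
      qed
    qed
  qed
qed

lemma defin_scons:
  assumes "rename_closed C" "defin M C P"
  obtains p \<sigma> where "C p" "simples \<sigma>" "\<And>x e. P (x ## e) = sat M (x ## \<sigma> e) p"
proof -
  from assms(2) obtain p \<sigma> where p: "C p" "simples \<sigma>" "P = (\<lambda>e. sat M (\<sigma> e) p)"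
    unfolding defin_def by blast
  obtain f \<tau> where t: "simples \<tau>" "\<And>x e. \<sigma> (x ## e) = (x ## \<tau> e) \<circ> f"
    by (rule simples_scons_split[OF p(2)]) (rule that)
  show ?thesis
  proof
    show "C (rename_fm f p)" using assms(1) p(1) by (simp add: rename_closed_def)
    show "P (x ## e) = sat M (x ## \<tau> e) (rename_fm f p)" for x e by (simp add: p(3) t(2) sat_rename)
  qed (fact t(1))
qed

context pa_model
begin

abbreviation "D0 \<equiv> defin M delta0"
abbreviation "Sg k \<equiv> defin M (sigma k)"
abbreviation "Pg k \<equiv> defin M (pi k)"

section \<open>Terms with parameters and closure properties of the definable classes\<close>

definition tm :: "((nat \<Rightarrow> 'd) \<Rightarrow> 'd) \<Rightarrow> bool" where
  "tm t \<longleftrightarrow> (\<exists>r \<sigma>. simples \<sigma> \<and> t = (\<lambda>e. tval M (\<sigma> e) r))"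

lemma tm_var: "tm (\<lambda>e. e j)"
  unfolding tm_def by (intro exI[of _ "TVar j"] exI[of _ "\<lambda>e. e"]) (simp add: simples_id)

lemma tm_const: "tm (\<lambda>e. c)"
  unfolding tm_def by (intro exI[of _ "TVar 0"] exI[of _ "\<lambda>e _. c"]) (simp add: simples_const)

lemma tm_subst:
  assumes "tm t" "simples \<tau>" shows "tm (\<lambda>e. t (\<tau> e))"
proof -
  from assms(1) obtain r \<sigma> where *: "simples \<sigma>" "t = (\<lambda>e. tval M (\<sigma> e) r)" unfolding tm_def by blast
  show ?thesis unfolding tm_def
    by (intro exI[of _ r] exI[of _ "\<lambda>e. \<sigma> (\<tau> e)"]) (simp add: * simples_comp assms(2))
qed

lemma tm_pair:
  assumes "tm s" "tm t"
  obtains p q \<sigma> where "simples \<sigma>" "s = (\<lambda>e. tval M (\<sigma> e) p)" "t = (\<lambda>e. tval M (\<sigma> e) q)"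
proof -
  from assms(1) obtain p \<sigma> where p: "simples \<sigma>" "s = (\<lambda>e. tval M (\<sigma> e) p)"
    unfolding tm_def by blast
  from assms(2) obtain q \<tau> where q: "simples \<tau>" "t = (\<lambda>e. tval M (\<tau> e) q)"
    unfolding tm_def by blast
  obtain \<rho> where r: "simples \<rho>" "\<And>e. \<rho> e \<circ> (\<lambda>i. 2 * i) = \<sigma> e" "\<And>e. \<rho> e \<circ> (\<lambda>i. Suc (2 * i)) = \<tau> e"
    using simples_merge[OF p(1) q(1)] by blast
  show ?thesis
    by (rule that[OF r(1), of "rename_tm (\<lambda>i. 2 * i) p" "rename_tm (\<lambda>i. Suc (2 * i)) q"])
      (simp_all add: p q tval_rename r(2,3))
qed

lemma tm_add: assumes "tm s" "tm t" shows "tm (\<lambda>e. s e \<oplus> t e)"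
proof -
  obtain p q \<sigma> where *: "simples \<sigma>" "s = (\<lambda>e. tval M (\<sigma> e) p)" "t = (\<lambda>e. tval M (\<sigma> e) q)"
    using tm_pair[OF assms] by blast
  show ?thesis unfolding tm_def
    by (intro exI[of _ "TPlus p q"] exI[of _ \<sigma>]) (simp add: *)
qed

lemma tm_mul: assumes "tm s" "tm t" shows "tm (\<lambda>e. s e \<otimes> t e)"
proof -
  obtain p q \<sigma> where *: "simples \<sigma>" "s = (\<lambda>e. tval M (\<sigma> e) p)" "t = (\<lambda>e. tval M (\<sigma> e) q)"
    using tm_pair[OF assms] by blast
  show ?thesis unfolding tm_def
    by (intro exI[of _ "TTimes p q"] exI[of _ \<sigma>]) (simp add: *)
qed

lemmas tm_intros = tm_var tm_const tm_add tm_mul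

lemma D0_eq: assumes "tm s" "tm t" shows "D0 (\<lambda>e. s e = t e)"
proof -
  obtain p q \<sigma> where *: "simples \<sigma>" "s = (\<lambda>e. tval M (\<sigma> e) p)" "t = (\<lambda>e. tval M (\<sigma> e) q)"
    using tm_pair[OF assms] by blast
  show ?thesis unfolding defin_def
    by (intro exI[of _ "FEq p q"] exI[of _ \<sigma>]) (simp add: * delta0.intros)
qed

lemma D0_lt: assumes "tm s" "tm t" shows "D0 (\<lambda>e. s e \<prec> t e)"
proof -
  obtain p q \<sigma> where *: "simples \<sigma>" "s = (\<lambda>e. tval M (\<sigma> e) p)" "t = (\<lambda>e. tval M (\<sigma> e) q)"
    using tm_pair[OF assms] by blast
  show ?thesis unfolding defin_def
    by (intro exI[of _ "FLt p q"] exI[of _ \<sigma>]) (simp add: * delta0.intros)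
qed

lemma D0_not: assumes "D0 P" shows "D0 (\<lambda>e. \<not> P e)"
proof -
  from assms obtain p \<sigma> where *: "delta0 p" "simples \<sigma>" "P = (\<lambda>e. sat M (\<sigma> e) p)"
    unfolding defin_def by blast
  show ?thesis unfolding defin_def
    by (intro exI[of _ "FNeg p"] exI[of _ \<sigma>]) (simp add: * delta0.intros)
qed

lemma D0_and: assumes "D0 P" "D0 Q" shows "D0 (\<lambda>e. P e \<and> Q e)"
proof -
  obtain p q \<sigma> where *: "delta0 p" "delta0 q" "simples \<sigma>" "P = (\<lambda>e. sat M (\<sigma> e) p)" "Q = (\<lambda>e. sat M (\<sigma> e) q)"
    using defin_pair[OF rename_closed(1) rename_closed(1) assms] by blast
  show ?thesis unfolding defin_def
    by (intro exI[of _ "FAnd p q"] exI[of _ \<sigma>]) (simp add: * delta0.intros)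
qed

lemma D0_imp: assumes "D0 P" "D0 Q" shows "D0 (\<lambda>e. P e \<longrightarrow> Q e)"
  using D0_not[OF D0_and[OF assms(1) D0_not[OF assms(2)]]] by simp

text \<open>Writing the body as a function of \<open>e 0\<close> and the tail lets
  \<open>intro\<close> peel off one quantifier by unification: the head is the bound variable, the
  tail the outer environment. All quantifier rules below share this shape.\<close>

lemma D0_bex:
  assumes "D0 (\<lambda>e. P (e 0) (\<lambda>i. e (Suc i)))" "tm t" shows "D0 (\<lambda>e. \<exists>x. x \<prec> t e \<and> P x e)"
proof -
  obtain p \<sigma> where p: "delta0 p" "simples \<sigma>"
    "\<And>x e. P ((x ## e) 0) (\<lambda>i. (x ## e) (Suc i)) = sat M (x ## \<sigma> e) p"
    using defin_scons[OF rename_closed(1) assms(1)] by blast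
  from assms(2) obtain r \<tau> where r: "simples \<tau>" "t = (\<lambda>e. tval M (\<tau> e) r)" unfolding tm_def by blast
  obtain \<rho> where m: "simples \<rho>" "\<And>e. \<rho> e \<circ> (\<lambda>i. 2 * i) = \<sigma> e" "\<And>e. \<rho> e \<circ> (\<lambda>i. Suc (2 * i)) = \<tau> e"
    using simples_merge[OF p(2) r(1)] by blast
  let ?p = "FEx (FAnd (FLt (TVar 0) (lift_tm 0 (rename_tm (\<lambda>i. Suc (2 * i)) r)))
    (rename_fm (shiftr (\<lambda>i. 2 * i)) p))"
  have "delta0 ?p" by (intro delta0.intros delta0_rename p)
  moreover have "(\<lambda>e. \<exists>x. x \<prec> t e \<and> P x e) = (\<lambda>e. sat M (\<rho> e) ?p)"
    using p(3) by (simp add: tval_lift tval_rename sat_rename scons_shiftr m(2,3) r(2))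
  ultimately show ?thesis unfolding defin_def using m(1) by blast
qed

lemma D0_ball:
  assumes "D0 (\<lambda>e. P (e 0) (\<lambda>i. e (Suc i)))" "tm t" shows "D0 (\<lambda>e. \<forall>x. x \<prec> t e \<longrightarrow> P x e)"
  using D0_not[OF D0_bex[OF D0_not[OF assms(1)] assms(2)]] by simp

lemmas D0_intros = D0_eq D0_lt D0_not D0_and D0_imp D0_bex D0_ball

lemma Sg_D0: "D0 P \<Longrightarrow> Sg k P" and Pg_D0: "D0 P \<Longrightarrow> Pg k P"
  unfolding defin_def using sigma_mono[OF sigma_pi.intros(1) le0] pi_mono[OF sigma_pi.intros(2) le0]
  by blast+

lemma D0_iff_Sg: "D0 = Sg 0"
proof -
  have "sigma 0 = delta0" by (auto elim: sigma.cases intro: sigma_pi.intros)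
  then show ?thesis by simp
qed

lemma Sg_mono: "Sg k P \<Longrightarrow> k \<le> l \<Longrightarrow> Sg l P" and Pg_mono: "Pg k P \<Longrightarrow> k \<le> l \<Longrightarrow> Pg l P"
  unfolding defin_def using sigma_mono pi_mono by blast+

lemma Sg_Suc_Pg: "Pg k P \<Longrightarrow> Sg (Suc k) P" and Pg_Suc_Sg: "Sg k P \<Longrightarrow> Pg (Suc k) P"
  unfolding defin_def using sigma_pi.intros(3,4) by blast+

lemma Pg_not: assumes "Sg k P" shows "Pg k (\<lambda>e. \<not> P e)"
proof -
  from assms obtain p \<sigma> where *: "sigma k p" "simples \<sigma>" "P = (\<lambda>e. sat M (\<sigma> e) p)"
    unfolding defin_def by blast
  from sigma_pi_neg(1)[OF *(1)] obtain q where "pi k q" "\<forall>(M :: 'd str) e. sat M e q = (\<not> sat M e p)" by blast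
  then show ?thesis using *(2) unfolding defin_def
    by (intro exI[of _ q] exI[of _ \<sigma>]) (simp add: *(3))
qed

lemma Sg_not: assumes "Pg k P" shows "Sg k (\<lambda>e. \<not> P e)"
proof -
  from assms obtain p \<sigma> where *: "pi k p" "simples \<sigma>" "P = (\<lambda>e. sat M (\<sigma> e) p)"
    unfolding defin_def by blast
  from sigma_pi_neg(2)[OF *(1)] obtain q where "sigma k q" "\<forall>(M :: 'd str) e. sat M e q = (\<not> sat M e p)" by blast
  then show ?thesis using *(2) unfolding defin_def
    by (intro exI[of _ q] exI[of _ \<sigma>]) (simp add: *(3))
qed

lemma Sg_and: assumes "Sg k P" "Sg k Q" shows "Sg k (\<lambda>e. P e \<and> Q e)"
proof -
  obtain p q \<sigma> where *: "sigma k p" "sigma k q" "simples \<sigma>" "P = (\<lambda>e. sat M (\<sigma> e) p)" "Q = (\<lambda>e. sat M (\<sigma> e) q)"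
    using defin_pair[OF rename_closed(2) rename_closed(2) assms] by blast
  from sigma_and_or[OF *(1,2), of True] obtain r
    where "sigma k r" "\<forall>(M :: 'd str) e. sat M e r = (sat M e p \<and> sat M e q)" by auto
  then show ?thesis using *(3) unfolding defin_def
    by (intro exI[of _ r] exI[of _ \<sigma>]) (simp add: *(4,5))
qed

lemma Sg_or: assumes "Sg k P" "Sg k Q" shows "Sg k (\<lambda>e. P e \<or> Q e)"
proof -
  obtain p q \<sigma> where *: "sigma k p" "sigma k q" "simples \<sigma>" "P = (\<lambda>e. sat M (\<sigma> e) p)" "Q = (\<lambda>e. sat M (\<sigma> e) q)"
    using defin_pair[OF rename_closed(2) rename_closed(2) assms] by blast
  from sigma_and_or[OF *(1,2), of False] obtain r
    where "sigma k r" "\<forall>(M :: 'd str) e. sat M e r = (sat M e p \<or> sat M e q)" by auto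
  then show ?thesis using *(3) unfolding defin_def
    by (intro exI[of _ r] exI[of _ \<sigma>]) (simp add: *(4,5))
qed

lemma Pg_and: assumes "Pg k P" "Pg k Q" shows "Pg k (\<lambda>e. P e \<and> Q e)"
  using Pg_not[OF Sg_or[OF Sg_not[OF assms(1)] Sg_not[OF assms(2)]]] by simp

lemma Sg_imp: assumes "Pg k P" "Sg k Q" shows "Sg k (\<lambda>e. P e \<longrightarrow> Q e)"
  using Sg_or[OF Sg_not[OF assms(1)] assms(2)] by simp

lemma Pg_imp: assumes "Sg k P" "Pg k Q" shows "Pg k (\<lambda>e. P e \<longrightarrow> Q e)"
  using Pg_not[OF Sg_and[OF assms(1) Sg_not[OF assms(2)]]] by simp

lemma Sg_ex:
  assumes "Sg (Suc k) (\<lambda>e. P (e 0) (\<lambda>i. e (Suc i)))" shows "Sg (Suc k) (\<lambda>e. \<exists>x. P x e)"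
proof -
  obtain p \<sigma> where p: "sigma (Suc k) p" "simples \<sigma>"
    "\<And>x e. P ((x ## e) 0) (\<lambda>i. (x ## e) (Suc i)) = sat M (x ## \<sigma> e) p"
    using defin_scons[OF rename_closed(2) assms(1)] by blast
  then show ?thesis unfolding defin_def
    by (intro exI[of _ "FEx p"] exI[of _ \<sigma>]) (auto intro: sigma_pi.intros)
qed

lemma Pg_all:
  assumes "Pg (Suc k) (\<lambda>e. P (e 0) (\<lambda>i. e (Suc i)))" shows "Pg (Suc k) (\<lambda>e. \<forall>x. P x e)"
  using Pg_not[OF Sg_ex[OF Sg_not[OF assms]]] by simp

section \<open>Induction and bounded quantification\<close>

text \<open>A hypothesis on the level rather than a lemma, because it depends on induction in the
  model: normal form and collection at level k + 1 use it at level k, and together they yield it at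
  level k + 1.\<close>

definition bounded_closed :: "nat \<Rightarrow> bool" where
  "bounded_closed k \<longleftrightarrow> (\<forall>P t. Sg k (\<lambda>e. P (e 0) (\<lambda>i. e (Suc i))) \<longrightarrow> tm t \<longrightarrow>
     Sg k (\<lambda>e. \<exists>x. x \<prec> t e \<and> P x e) \<and> Sg k (\<lambda>e. \<forall>x. x \<prec> t e \<longrightarrow> P x e))"

lemma Sg_bex:
  "bounded_closed k \<Longrightarrow> Sg k (\<lambda>e. P (e 0) (\<lambda>i. e (Suc i))) \<Longrightarrow> tm t \<Longrightarrow> Sg k (\<lambda>e. \<exists>x. x \<prec> t e \<and> P x e)"
  and Sg_ball:
  "bounded_closed k \<Longrightarrow> Sg k (\<lambda>e. P (e 0) (\<lambda>i. e (Suc i))) \<Longrightarrow> tm t \<Longrightarrow> Sg k (\<lambda>e. \<forall>x. x \<prec> t e \<longrightarrow> P x e)"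
  unfolding bounded_closed_def by blast+

lemma Pg_bex:
  assumes "bounded_closed k" "Pg k (\<lambda>e. P (e 0) (\<lambda>i. e (Suc i)))" "tm t"
  shows "Pg k (\<lambda>e. \<exists>x. x \<prec> t e \<and> P x e)"
  using Pg_not[OF Sg_ball[OF assms(1) Sg_not[OF assms(2)] assms(3)]] by simp

lemma Pg_ball:
  assumes "bounded_closed k" "Pg k (\<lambda>e. P (e 0) (\<lambda>i. e (Suc i)))" "tm t"
  shows "Pg k (\<lambda>e. \<forall>x. x \<prec> t e \<longrightarrow> P x e)"
  using Pg_not[OF Sg_bex[OF assms(1) Sg_not[OF assms(2)] assms(3)]] by simp

lemma lt_add_one: "x \<prec> x \<oplus> \<one>"
  by (simp add: lt_succ)

lemma lt_add_add_one: "x \<prec> x \<oplus> y \<oplus> \<one>" "y \<prec> x \<oplus> y \<oplus> \<one>"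
  using le_add[of x y] le_add[of y x] add_comm[of x y] by (simp_all add: lt_succ)

lemma Sg_Suc_normal_form:
  assumes b: "bounded_closed k" and "Sg (Suc k) P"
  obtains Q where "Pg k Q" "\<And>e. P e \<longleftrightarrow> (\<exists>w. Q (w ## e))"
proof -
  have nf: "\<exists>Q. Pg k Q \<and> (\<forall>e. sat M e p \<longleftrightarrow> (\<exists>w. Q (w ## e)))" if "sigma (Suc k) p" for p
    using that
  proof (induction rule: sigma_Suc_induct)
    case (pi p)
    then have "Pg k (\<lambda>e. sat M e p)" unfolding defin_def using simples_id by blast
    from defin_subst[OF this simples_rename[of Suc]] have "Pg k (\<lambda>e. sat M (\<lambda>i. e (Suc i)) p)" .
    then show ?case by (rule_tac exI[of _ "\<lambda>e. sat M (\<lambda>i. e (Suc i)) p"]) simp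
  next
    case (ex p)
    then obtain Q where Q: "Pg k Q" "\<And>e. sat M e p \<longleftrightarrow> (\<exists>w. Q (w ## e))" by blast
    \<comment> \<open>Two witnesses are contracted into a common strict upper bound, for instance w
      + x + 1, which replaces a pairing function.\<close>
    let ?Q = "\<lambda>e. \<exists>w. w \<prec> e 0 \<and> (\<exists>x. x \<prec> e 0 \<and> Q (w ## x ## (\<lambda>i. e (Suc i))))"
    have "Pg k ?Q"
      by (intro Pg_bex[OF b] tm_intros defin_subst[OF Q(1)] simples_intros)
    moreover have "sat M e (FEx p) \<longleftrightarrow> (\<exists>v. ?Q (v ## e))" for e
      using Q(2) lt_add_add_one by fastforce
    ultimately show ?case by blast
  qed
  from assms(2) obtain p \<sigma> where p: "sigma (Suc k) p" "simples \<sigma>" "P = (\<lambda>e. sat M (\<sigma> e) p)"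
    unfolding defin_def by blast
  obtain Q where Q: "Pg k Q" "\<And>e. sat M e p \<longleftrightarrow> (\<exists>w. Q (w ## e))" using nf[OF p(1)] by blast
  show ?thesis
  proof
    show "Pg k (\<lambda>e. Q (e 0 ## \<sigma> (\<lambda>i. e (Suc i))))"
      by (intro defin_subst[OF Q(1)] simples_scons simple_var simples_comp[OF p(2)] simples_rename)
    show "P e \<longleftrightarrow> (\<exists>w. Q ((w ## e) 0 ## \<sigma> (\<lambda>i. (w ## e) (Suc i))))" for e
      using Q(2) p(3) by simp
  qed
qed

definition IS :: "nat \<Rightarrow> bool" where
  "IS k \<longleftrightarrow> (\<forall>Z. Sg k (\<lambda>e. Z (e 0)) \<longrightarrow> Z \<zero> \<longrightarrow> (\<forall>x. Z x \<longrightarrow> Z (x \<oplus> \<one>)) \<longrightarrow> (\<forall>x. Z x))"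

lemma IS_induct:
  assumes "IS k" "Sg k (\<lambda>e. Z (e 0))" "Z \<zero>" "\<And>x. Z x \<Longrightarrow> Z (x \<oplus> \<one>)"
  shows "Z x"
  using assms unfolding IS_def by blast

lemma IS_mono: "IS l \<Longrightarrow> k \<le> l \<Longrightarrow> IS k"
  unfolding IS_def using Sg_mono by blast

text \<open>Induction on the length z of the initial segment that already has a bound. The statement
  is Sigma_{k+1}, since the quantifiers after the bound v are bounded and stay in Pi_k. In the step
  the old bound is added to the new witness.\<close>

lemma collection:
  assumes b: "bounded_closed k" and IS: "IS (Suc k)" and Q: "Pg k (\<lambda>e. Q (e 0) (e 1))"
    and all: "\<And>x. x \<prec> a \<Longrightarrow> \<exists>w. Q w x"
  shows "\<exists>v. \<forall>x. x \<prec> a \<longrightarrow> (\<exists>w. w \<prec> v \<and> Q w x)"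
proof -
  let ?Z = "\<lambda>z. \<exists>v. \<forall>x. x \<prec> z \<longrightarrow> x \<prec> a \<longrightarrow> (\<exists>w. w \<prec> v \<and> Q w x)"
  have Q': "Pg k (\<lambda>e. Q (e i) (e j))" for i j
    using defin_rename2[OF Q] .
  have "?Z a"
  proof (rule IS_induct[OF IS, of ?Z])
    show "Sg (Suc k) (\<lambda>e. ?Z (e 0))"
      by (intro Sg_ex Sg_Suc_Pg[of k] Pg_ball[OF b] Pg_imp Sg_D0 D0_intros Pg_bex[OF b] tm_intros Q')
    show "?Z \<zero>" using not_lt_zero by blast
    fix z assume "?Z z"
    then obtain v where v: "\<And>x. x \<prec> z \<Longrightarrow> x \<prec> a \<Longrightarrow> \<exists>w. w \<prec> v \<and> Q w x" by blast
    show "?Z (z \<oplus> \<one>)"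
    proof (cases "z \<prec> a")
      case True
      then obtain w where w: "Q w z" using all by blast
      have "\<exists>w'. w' \<prec> w \<oplus> v \<oplus> \<one> \<and> Q w' x" if "x \<prec> z \<oplus> \<one>" "x \<prec> a" for x
      proof (cases "x = z")
        case True
        then show ?thesis using w lt_add_add_one by blast
      next
        case False
        then have "x \<prec> z" using that(1) unfolding lt_succ le_def by blast
        then show ?thesis using v[OF _ that(2)] lt_trans lt_add_add_one by blast
      qed
      then show ?thesis by blast
    next
      case False
      then show ?thesis using v unfolding lt_succ le_def by metis
    qed
  qed
  then show ?thesis by blast
qed

lemma bounded_closed_0: "bounded_closed 0"
  unfolding bounded_closed_def D0_iff_Sg[symmetric] using D0_bex D0_ball by blast

text \<open>Only the universal case has content: collection bounds the witnesses w uniformly by some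
  v, so the unbounded existential quantifier moves in front of the bounded universal one.\<close>

lemma bounded_closed_Suc:
  assumes b: "bounded_closed k" and IS: "IS (Suc k)"
  shows "bounded_closed (Suc k)"
  unfolding bounded_closed_def
proof (intro allI impI conjI)
  fix P :: "'d \<Rightarrow> (nat \<Rightarrow> 'd) \<Rightarrow> bool" and t
  assume P: "Sg (Suc k) (\<lambda>e. P (e 0) (\<lambda>i. e (Suc i)))" and t: "tm t"
  have t': "tm (\<lambda>e. t (\<lambda>i. e (Suc i)))" by (rule tm_subst[OF t simples_rename])
  show "Sg (Suc k) (\<lambda>e. \<exists>x. x \<prec> t e \<and> P x e)"
    by (intro Sg_ex Sg_and Sg_D0 D0_lt tm_var t' P)
  obtain Q where Q: "Pg k Q" "\<And>e. P (e 0) (\<lambda>i. e (Suc i)) \<longleftrightarrow> (\<exists>w. Q (w ## e))"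
    using Sg_Suc_normal_form[OF b P] by blast
  have PQ: "P x e \<longleftrightarrow> (\<exists>w. Q (w ## x ## e))" for x e using Q(2)[of "x ## e"] by simp
  have "(\<forall>x. x \<prec> t e \<longrightarrow> P x e) \<longleftrightarrow> (\<exists>v. \<forall>x. x \<prec> t e \<longrightarrow> (\<exists>w. w \<prec> v \<and> Q (w ## x ## e)))" for e
  proof
    assume "\<forall>x. x \<prec> t e \<longrightarrow> P x e"
    then have "\<And>x. x \<prec> t e \<Longrightarrow> \<exists>w. Q (w ## x ## e)" by (simp add: PQ)
    moreover have "Pg k (\<lambda>e'. Q (e' 0 ## e' 1 ## e))"
      by (intro defin_subst[OF Q(1)] simples_intros)
    ultimately show "\<exists>v. \<forall>x. x \<prec> t e \<longrightarrow> (\<exists>w. w \<prec> v \<and> Q (w ## x ## e))"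
      using collection[OF b IS, of "\<lambda>w x. Q (w ## x ## e)"] by blast
  qed (auto simp: PQ)
  moreover have "Sg (Suc k) (\<lambda>e. \<exists>v. \<forall>x. x \<prec> t e \<longrightarrow> (\<exists>w. w \<prec> v \<and> Q (w ## x ## e)))"
    by (intro Sg_ex Sg_Suc_Pg Pg_ball[OF b] Pg_bex[OF b] defin_subst[OF Q(1)] tm_intros t' simples_intros)
  ultimately show "Sg (Suc k) (\<lambda>e. \<forall>x. x \<prec> t e \<longrightarrow> P x e)" by simp
qed

lemma IS_bounded_closed: "IS k \<Longrightarrow> bounded_closed k"
proof (induction k)
  case (Suc k)
  then show ?case using bounded_closed_Suc IS_mono[of "Suc k" k] by simp
qed (simp add: bounded_closed_0)

text \<open>Induction downwards from a counterexample a: that Z fails at a - z is a Sigma_k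
  condition on z and is inherited by z + 1, so Z would fail at 0.\<close>

lemma IS_induct_Pg:
  assumes IS: "IS k" and Z: "Pg k (\<lambda>e. Z (e 0))" and "Z \<zero>" and step: "\<And>x. Z x \<Longrightarrow> Z (x \<oplus> \<one>)"
  shows "Z a"
proof (rule ccontr)
  assume "\<not> Z a"
  note b = IS_bounded_closed[OF IS]
  have Z': "Pg k (\<lambda>e. Z (e i))" for i
    using defin_rename1[OF Z] .
  let ?Y = "\<lambda>z. \<exists>w. w \<prec> a \<oplus> \<one> \<and> w \<oplus> z = a \<and> \<not> Z w"
  have "?Y a"
  proof (rule IS_induct[OF IS, of ?Y])
    show "Sg k (\<lambda>e. ?Y (e 0))"
      by (intro Sg_bex[OF b] Sg_and Sg_not Z' Sg_D0 D0_eq tm_intros)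
    show "?Y \<zero>" using \<open>\<not> Z a\<close> lt_add_one add_zero by blast
    fix z assume "?Y z"
    then obtain w where w: "w \<prec> a \<oplus> \<one>" "w \<oplus> z = a" "\<not> Z w" by blast
    then obtain u where u: "w = u \<oplus> \<one>" using zero_or_succ \<open>Z \<zero>\<close> by metis
    then have "\<not> Z u" using step w(3) by blast
    moreover have "u \<prec> a \<oplus> \<one>" using lt_add_one[of u] w(1) lt_trans u by blast
    moreover have "u \<oplus> (z \<oplus> \<one>) = a" using w(2) u add_assoc add_comm by metis
    ultimately show "?Y (z \<oplus> \<one>)" by blast
  qed
  then obtain w where w: "w \<oplus> a = a" "\<not> Z w" by blast
  then have "w = \<zero>" using add_cancel[of a w \<zero>] add_comm add_zero by metis
  then show False using w \<open>Z \<zero>\<close> by simp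
qed

text \<open>Without a least element, "nothing below z lies in X" is a Pi_k condition that propagates
  to z + 1. The cap at a + 1 confines it to the range where the negated conclusion gives a smaller
  element.\<close>

lemma least_Sg:
  assumes IS: "IS k" and X: "Sg k (\<lambda>e. X (e 0))" and "X a"
  shows "\<exists>y. y \<preceq> a \<and> X y \<and> (\<forall>z. z \<prec> y \<longrightarrow> \<not> X z)"
proof (rule ccontr)
  assume no: "\<not> ?thesis"
  note b = IS_bounded_closed[OF IS]
  have X': "Sg k (\<lambda>e. X (e i))" for i
    using defin_rename1[OF X] .
  let ?Z = "\<lambda>z. \<forall>y. y \<prec> z \<longrightarrow> y \<prec> a \<oplus> \<one> \<longrightarrow> \<not> X y"
  have "?Z (a \<oplus> \<one>)"
  proof (rule IS_induct_Pg[OF IS, of ?Z])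
    show "Pg k (\<lambda>e. ?Z (e 0))"
      by (intro Pg_ball[OF b] Pg_imp Pg_not X' Sg_D0 D0_lt tm_intros)
    show "?Z \<zero>" using not_lt_zero by blast
    fix z assume Z: "?Z z"
    have "\<not> X z" if za: "z \<preceq> a"
    proof
      assume "X z"
      then obtain y where "y \<prec> z" "X y" using no za by blast
      moreover have "y \<prec> a \<oplus> \<one>" using \<open>y \<prec> z\<close> za lt_trans unfolding lt_succ le_def by blast
      ultimately show False using Z by blast
    qed
    then show "?Z (z \<oplus> \<one>)" using Z unfolding lt_succ le_def by blast
  qed
  then show False using \<open>X a\<close> lt_add_one by blast
qed

section \<open>From weak regularity to induction\<close>

definition WRs :: "nat \<Rightarrow> bool" where
  "WRs k \<longleftrightarrow> (\<forall>P Q a. Sg k (\<lambda>e. P (e 0) (e 1)) \<longrightarrow> Pg k (\<lambda>e. Q (e 0) (e 1)) \<longrightarrow>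
     (\<forall>x. \<exists>y. y \<prec> a \<and> P x y \<and> Q x y) \<longrightarrow> (\<exists>y. y \<prec> a \<and> (\<forall>b. \<exists>x. b \<prec> x \<and> P x y \<and> Q x y)))"

lemma WRs_mono: "WRs l \<Longrightarrow> k \<le> l \<Longrightarrow> WRs k"
  unfolding WRs_def using Sg_mono Pg_mono by blast

text \<open>A failure of Z at a bounds the colours, as a itself never gets a witness. The two
  clauses defining the least colour are the Sigma_k part and the Pi_k part to which weak regularity
  is applied.\<close>

lemma IS_Suc_of_WRs:
  assumes IS: "IS k" and WR: "WRs k" shows "IS (Suc k)"
  unfolding IS_def
proof (intro allI impI)
  fix Z and a
  assume Z: "Sg (Suc k) (\<lambda>e. Z (e 0))" "Z \<zero>" "\<forall>x. Z x \<longrightarrow> Z (x \<oplus> \<one>)"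
  note b = IS_bounded_closed[OF IS]
  obtain Q where Q: "Pg k Q" "\<And>e. Z (e 0) \<longleftrightarrow> (\<exists>w. Q (w ## e))"
    using Sg_Suc_normal_form[OF b Z(1)] by blast
  define \<theta> where "\<theta> u y = Q (u ## y ## (\<lambda>_. \<zero>))" for u y
  have Z\<theta>: "Z y \<longleftrightarrow> (\<exists>u. \<theta> u y)" for y using Q(2)[of "y ## (\<lambda>_. \<zero>)"] by (simp add: \<theta>_def)
  have \<theta>: "simple u \<Longrightarrow> simple v \<Longrightarrow> Pg k (\<lambda>e. \<theta> (u e) (v e))" for u v
    unfolding \<theta>_def by (intro defin_subst[OF Q(1)] simples_intros)
  text \<open>The colour of x is the least y without a witness below x.\<close>
  let ?P = "\<lambda>x y. \<forall>u. u \<prec> x \<longrightarrow> \<not> \<theta> u y"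
  let ?R = "\<lambda>x y. \<forall>z. z \<prec> y \<longrightarrow> (\<exists>u. u \<prec> x \<and> \<theta> u z)"
  \<comment> \<open>The term u is a parameter when the least colour of a fixed x is sought, and a
    variable when weak regularity is applied.\<close>
  have P: "Sg k (\<lambda>e. ?P (u e) (e i))" if "tm u" for u i
    using tm_subst[OF that simples_rename[of Suc]]
    by (intro Sg_ball[OF b] Sg_not \<theta> simples_intros) (rule that)
  have R: "Pg k (\<lambda>e. ?R (e 0) (e 1))"
    by (intro Pg_ball[OF b] Pg_bex[OF b] \<theta> simples_intros tm_intros)
  show "Z a"
  proof (rule ccontr)
    assume "\<not> Z a"
    have "\<exists>y. y \<prec> a \<oplus> \<one> \<and> ?P x y \<and> ?R x y" for x
    proof -
      have "?P x a" using \<open>\<not> Z a\<close> Z\<theta> by blast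
      from least_Sg[OF IS P[OF tm_const] this] show ?thesis unfolding lt_succ by blast
    qed
    then obtain y where y: "\<And>b. \<exists>x. b \<prec> x \<and> ?P x y \<and> ?R x y"
      using WR[unfolded WRs_def, rule_format, of ?P ?R "a \<oplus> \<one>"] P[OF tm_var] R by blast
    \<comment> \<open>A witness u for y would be seen by every x > u, yet some x > u has colour y.
      Hence y is the first element outside Z, and it can be neither zero nor a successor.\<close>
    have "\<not> \<theta> u y" for u using y[of u] by blast
    then have "\<not> Z y" using Z\<theta> by blast
    moreover have "Z z" if "z \<prec> y" for z using y that Z\<theta> by blast
    ultimately show False using zero_or_succ[of y] Z(2,3) lt_add_one by blast
  qed
qed

end

context pa_model
begin

section \<open>From induction to weak regularity\<close>

abbreviation dv where "dv \<equiv> dvd.dvd (\<otimes>)"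

text \<open>Bounding the quotient makes divisibility Delta_0. If x = 0 then y = 0 and the quotient
  may be taken to be 0; otherwise it is at most y.\<close>

lemma dv_iff: "dv x y \<longleftrightarrow> (\<exists>j. j \<prec> y \<oplus> \<one> \<and> x \<otimes> j = y)"
proof
  assume "dv x y"
  then obtain j where j: "y = x \<otimes> j" by (rule sr.dvdE)
  show "\<exists>j. j \<prec> y \<oplus> \<one> \<and> x \<otimes> j = y"
  proof (cases "x = \<zero>")
    case True
    then have "x \<otimes> \<zero> = y" using j by simp
    then show ?thesis using sr.add_strict_increasing2[of "y" \<zero> \<one>] zero_min[of y] lt_succ[of \<zero> y]
      unfolding le_def by metis
  next
    case False
    then have "\<one> \<preceq> x" using zero_min[of x] discrete[of x] unfolding le_def by metis
    then have "j \<preceq> y" using sr.mult_right_mono[of \<one> x j] j zero_min[of j] unfolding le_def by auto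
    then show ?thesis using j lt_succ by blast
  qed
next
  assume "\<exists>j. j \<prec> y \<oplus> \<one> \<and> x \<otimes> j = y"
  then show "dv x y" by (auto intro: sr.dvdI)
qed

lemma D0_dv: assumes "tm s" "tm t" shows "D0 (\<lambda>e. dv (s e) (t e))"
  unfolding dv_iff
  by (intro D0_intros tm_intros assms tm_subst[OF assms(1) simples_rename[of Suc]]
      tm_subst[OF assms(2) simples_rename[of Suc]])

lemma division:
  assumes IS: "IS 0" and c: "\<zero> \<prec> c"
  shows "\<exists>k r. x = c \<otimes> k \<oplus> r \<and> r \<prec> c"
proof -
  \<comment> \<open>The explicit bounds on quotient and remainder keep the formula Delta_0, so
    \<open>IS 0\<close> suffices.\<close>
  let ?Z = "\<lambda>x. \<exists>k. k \<prec> x \<oplus> \<one> \<and> (\<exists>r. r \<prec> c \<and> x = c \<otimes> k \<oplus> r)"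
  have "?Z x"
  proof (rule IS_induct[OF IS, of ?Z])
    show "Sg 0 (\<lambda>e. ?Z (e 0))" by (intro Sg_D0 D0_intros tm_intros)
    show "?Z \<zero>" using c lt_add_one[of \<zero>] add_zero mul_zero by metis
    fix x assume "?Z x"
    then obtain k r where k: "k \<prec> x \<oplus> \<one>" "r \<prec> c" "x = c \<otimes> k \<oplus> r" by blast
    have kx: "k \<prec> x \<oplus> \<one> \<oplus> \<one>" using k(1) lt_add_one lt_trans by blast
    consider "r \<oplus> \<one> \<prec> c" | "r \<oplus> \<one> = c"
      using k(2) lt_linear[of "r \<oplus> \<one>" c] unfolding lt_succ le_def by (metis lt_irrefl lt_trans)
    then show "?Z (x \<oplus> \<one>)"
    proof cases
      case 1
      have "x \<oplus> \<one> = c \<otimes> k \<oplus> (r \<oplus> \<one>)" using k(3) by (simp add: add_assoc)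
      then show ?thesis using kx 1 by blast
    next
      case 2
      have "x \<oplus> \<one> = c \<otimes> (k \<oplus> \<one>) \<oplus> \<zero>"
        by (simp add: k(3) 2 add_assoc mul_add_distrib mul_one add_zero)
      moreover have "k \<oplus> \<one> \<prec> x \<oplus> \<one> \<oplus> \<one>" using k(1) by (rule lt_add_mono)
      ultimately show ?thesis using c by blast
    qed
  qed
  then show ?thesis by blast
qed

text \<open>Take the least positive c with v | c q. By division with remainder c divides every x
  with v | x q, in particular v and s, so c = 1. This avoids Bezout coefficients.\<close>

lemma gauss:
  assumes IS: "IS 0" and v: "\<zero> \<prec> v" and dv: "dv v (s \<otimes> q)"
    and cop: "\<And>d. dv d v \<Longrightarrow> dv d s \<Longrightarrow> d = \<one>"
  shows "dv v q"
proof -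
  let ?X = "\<lambda>c. \<zero> \<prec> c \<and> dv v (c \<otimes> q)"
  have "Sg 0 (\<lambda>e. ?X (e 0))" by (intro Sg_D0 D0_intros D0_dv tm_intros)
  moreover have "?X v" using v by simp
  ultimately obtain c where c: "?X c" "\<And>z. z \<prec> c \<Longrightarrow> \<not> ?X z"
    using least_Sg[OF IS, of ?X] by blast
  have "dv c x" if "dv v (x \<otimes> q)" for x
  proof -
    obtain k r where k: "x = c \<otimes> k \<oplus> r" "r \<prec> c" using division[OF IS] c(1) by blast
    have "x \<otimes> q = k \<otimes> (c \<otimes> q) \<oplus> r \<otimes> q"
      using mul_assoc[of k c q] mul_comm[of c k] by (simp add: k(1) sr.distrib_right)
    then have "dv v (r \<otimes> q)" using that c(1) sr.dvd_add_right_iff[of v "k \<otimes> (c \<otimes> q)" "r \<otimes> q"] by simp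
    then have "r = \<zero>" using c(2)[OF k(2)] zero_min by blast
    then show ?thesis using k(1) by simp
  qed
  then have "c = \<one>" using cop[of c] dv by simp
  then show ?thesis using c(1) by simp
qed

text \<open>A substitute for the factorial. The multiple m is quantified without a bound, which is
  where \<open>IS 1\<close> enters.\<close>

lemma common_multiple:
  assumes IS: "IS 1"
  shows "\<exists>m. \<zero> \<prec> m \<and> (\<forall>i. i \<prec> z \<longrightarrow> \<zero> \<prec> i \<longrightarrow> dv i m)"
proof -
  let ?Z = "\<lambda>z. \<exists>m. \<zero> \<prec> m \<and> (\<forall>i. i \<prec> z \<longrightarrow> \<zero> \<prec> i \<longrightarrow> dv i m)"
  show "?Z z"
  proof (rule IS_induct[OF IS, of ?Z])
    show "Sg 1 (\<lambda>e. ?Z (e 0))"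
      unfolding One_nat_def by (intro Sg_ex Sg_D0 D0_intros D0_dv tm_intros)
    show "?Z \<zero>" using zero_lt_one not_lt_zero by blast
    fix z assume "?Z z"
    then obtain m where m: "\<zero> \<prec> m" "\<And>i. i \<prec> z \<Longrightarrow> \<zero> \<prec> i \<Longrightarrow> dv i m" by blast
    show "?Z (z \<oplus> \<one>)"
    proof (cases "\<zero> \<prec> z")
      case True
      have "dv i (m \<otimes> z)" if "i \<prec> z \<oplus> \<one>" "\<zero> \<prec> i" for i
        using that m(2)[of i] unfolding lt_succ le_def by auto
      moreover have "\<zero> \<prec> m \<otimes> z" using True m(1) by simp
      ultimately show ?thesis by blast
    next
      case False
      then show ?thesis using m unfolding lt_succ le_def by metis
    qed
  qed
qed

text \<open>Without a maximum, the Pi_k condition that X has an element not below z would propagate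
  up to z = N + 1, against the bound.\<close>

lemma maximal_Pg:
  assumes IS: "IS k" and X: "Pg k (\<lambda>e. X (e 0))" and "X s0" and bd: "\<And>s. X s \<Longrightarrow> s \<preceq> N"
  shows "\<exists>s. X s \<and> (\<forall>t. s \<prec> t \<longrightarrow> \<not> X t)"
proof (rule ccontr)
  assume no: "\<not> ?thesis"
  note b = IS_bounded_closed[OF IS]
  have X': "Pg k (\<lambda>e. X (e i))" for i
    using defin_rename1[OF X] .
  let ?Z = "\<lambda>z. \<exists>s. s \<prec> N \<oplus> \<one> \<and> \<not> s \<prec> z \<and> X s"
  have "?Z (N \<oplus> \<one>)"
  proof (rule IS_induct_Pg[OF IS, of ?Z])
    show "Pg k (\<lambda>e. ?Z (e 0))"
      by (intro Pg_bex[OF b] Pg_and X' Pg_D0 D0_intros tm_intros)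
    show "?Z \<zero>" using bd[OF \<open>X s0\<close>] \<open>X s0\<close> not_lt_zero unfolding lt_succ by blast
    fix z assume "?Z z"
    then obtain s where s: "\<not> s \<prec> z" "X s" by blast
    then obtain t where t: "s \<prec> t" "X t" using no by blast
    then have "\<not> t \<prec> z \<oplus> \<one>" using s(1) lt_trans unfolding lt_succ le_def by blast
    then show "?Z (z \<oplus> \<one>)" using bd[OF t(2)] t(2) unfolding lt_succ by blast
  qed
  then show False by blast
qed

lemma dv_le: "dv d s \<Longrightarrow> \<zero> \<prec> s \<Longrightarrow> d \<preceq> s"
  unfolding dv_iff[of d s]
proof (elim exE conjE)
  fix j assume "\<zero> \<prec> s" "d \<otimes> j = s"
  then have "\<zero> \<prec> j" using zero_min[of j] mul_zero[of d] lt_irrefl by metis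
  then have "\<one> \<preceq> j" using discrete unfolding le_def by blast
  then show "d \<preceq> s"
    using sr.mult_left_mono[of \<one> j d] zero_min[of d] \<open>d \<otimes> j = s\<close> mul_one unfolding le_def by metis
qed

lemma dv_one: "dv d \<one> \<Longrightarrow> d = \<one>"
  using dv_le[of d \<one>] zero_lt_one zero_min[of d] discrete[of d] unfolding le_def
  by (metis lt_irrefl lt_trans sr.dvd_0_left)

text \<open>These are the moduli of the Goedel beta function. A common divisor d of two of them
  divides m (z - y) and is coprime to m, so d | z - y; as z - y < a divides m, also d | m, and d =
  1.\<close>

lemma godel_moduli_coprime:
  assumes IS: "IS 0" and m: "\<And>i. i \<prec> a \<Longrightarrow> \<zero> \<prec> i \<Longrightarrow> dv i m"
    and "y \<prec> a" "z \<prec> a" "y \<noteq> z" and d: "dv d (\<one> \<oplus> (y \<oplus> \<one>) \<otimes> m)" "dv d (\<one> \<oplus> (z \<oplus> \<one>) \<otimes> m)"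
  shows "d = \<one>"
proof -
  have *: "d = \<one>" if yz: "y \<prec> z" "z \<prec> a" and d: "dv d (\<one> \<oplus> (y \<oplus> \<one>) \<otimes> m)" "dv d (\<one> \<oplus> (z \<oplus> \<one>) \<otimes> m)" for y z
  proof -
    let ?v = "\<one> \<oplus> (y \<oplus> \<one>) \<otimes> m"
    obtain i where i: "y \<oplus> i = z" using lt_ex_add[OF yz(1)] by blast
    then have "i \<noteq> \<zero>" using yz(1) add_zero lt_irrefl by metis
    then have i0: "\<zero> \<prec> i" using zero_min by metis
    have "i \<preceq> z" using le_add[of i y] i add_comm by metis
    then have ia: "i \<prec> a" using yz(2) lt_trans unfolding le_def by blast
    have "\<one> \<oplus> (z \<oplus> \<one>) \<otimes> m = ?v \<oplus> m \<otimes> i"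
      using i by (simp add: mul_comm[of _ m] mul_add_distrib flip: i) (metis add_assoc add_comm)
    then have "dv d (m \<otimes> i)" using d sr.dvd_add_right_iff[of d ?v "m \<otimes> i"] by simp
    have cop: "x = \<one>" if "dv x ?v" "dv x m" for x
    proof -
      have "dv x ((y \<oplus> \<one>) \<otimes> m)" using that(2) by simp
      then have "dv x \<one>" using that(1) sr.dvd_add_left_iff[of x "(y \<oplus> \<one>) \<otimes> m" \<one>] by simp
      then show ?thesis by (rule dv_one)
    qed
    have "?v \<noteq> \<zero>"
      using le_add[of \<one> "(y \<oplus> \<one>) \<otimes> m"] zero_lt_one lt_trans lt_irrefl unfolding le_def by metis
    then have "\<zero> \<prec> d" using d(1) zero_min[of d] by (metis sr.dvd_0_left)
    have "dv d i"
      by (rule gauss[OF IS \<open>\<zero> \<prec> d\<close> \<open>dv d (m \<otimes> i)\<close>]) (use cop d(1) sr.dvd_trans in blast)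
    then have "dv d m" using m[OF ia i0] sr.dvd_trans by blast
    then show ?thesis using cop d(1) by blast
  qed
  show ?thesis using lt_linear[of y z] *[of y z] *[of z y] assms by blast
qed

text \<open>Positivity of k lets "some x > b with \<open>Rs s x\<close>" remain Sigma_k and "all x >
  w" remain Pi_k. The first makes unboundedness a Pi_{k+1} condition on s, the second makes
  collection applicable.\<close>

lemma WRs_of_IS:
  assumes IS: "IS (Suc k)" and k: "0 < k"
  shows "WRs k"
  unfolding WRs_def
proof (intro allI impI, rule ccontr)
  fix P Q a
  assume P: "Sg k (\<lambda>e. P (e 0) (e 1))" and Q: "Pg k (\<lambda>e. Q (e 0) (e 1))"
    and all: "\<forall>x. \<exists>y. y \<prec> a \<and> P x y \<and> Q x y"
    and no: "\<not> (\<exists>y. y \<prec> a \<and> (\<forall>b. \<exists>x. b \<prec> x \<and> P x y \<and> Q x y))"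
  obtain k' where k': "k = Suc k'" using k gr0_implies_Suc by blast
  have IS0: "IS 0" and IS1: "IS 1" and ISk: "IS k" using IS_mono[OF IS] k by simp_all
  note b = IS_bounded_closed[OF ISk]
  obtain m where m: "\<zero> \<prec> m" "\<And>i. i \<prec> a \<Longrightarrow> \<zero> \<prec> i \<Longrightarrow> dv i m"
    using common_multiple[OF IS1] by blast
  define v where "v y = \<one> \<oplus> (y \<oplus> \<one>) \<otimes> m" for y
  have v_tm: "tm t \<Longrightarrow> tm (\<lambda>e. v (t e))" for t unfolding v_def by (intro tm_intros)
  \<comment> \<open>Strictly above 1, so that multiplying a code by \<open>v y\<close> strictly
    increases it.\<close>
  have v1: "\<one> \<prec> v y" for y
  proof -
    have "\<zero> \<prec> (y \<oplus> \<one>) \<otimes> m"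
      using m(1) zero_min[of y] lt_add_one[of y] lt_trans sr.mult_pos_pos by metis
    from lt_add_mono[OF this, of \<one>] show ?thesis unfolding v_def using add_zero add_comm by metis
  qed
  have v0: "\<zero> \<prec> v y" for y using v1 zero_lt_one lt_trans by blast
  \<comment> \<open>As v is increasing, a common multiple of all positive numbers below
    \<open>v a\<close> is a multiple of every modulus.\<close>
  obtain N where N: "\<zero> \<prec> N" "\<And>y. y \<prec> a \<Longrightarrow> dv (v y) N"
  proof -
    obtain N where N: "\<zero> \<prec> N" "\<And>i. i \<prec> v a \<Longrightarrow> \<zero> \<prec> i \<Longrightarrow> dv i N"
      using common_multiple[OF IS1] by blast
    have "v y \<prec> v a" if "y \<prec> a" for y
      unfolding v_def using that m(1) lt_add_mono[of y a \<one>] mul_mono[of m "y \<oplus> \<one>" "a \<oplus> \<one>"]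
        lt_add_mono[of "(y \<oplus> \<one>) \<otimes> m" "(a \<oplus> \<one>) \<otimes> m" \<one>] add_comm by metis
    then show ?thesis using that N v0 by blast
  qed
  \<comment> \<open>A common factor is asked for, not divisibility by \<open>v y\<close>, because a
    maximal s is an arbitrary divisor of N. When E fails, s and \<open>v y\<close> are coprime, and
    so \<open>v y\<close> divides N / s.\<close>
  define E where "E y s \<longleftrightarrow> (\<exists>d. d \<prec> s \<oplus> \<one> \<and> \<one> \<prec> d \<and> dv d s \<and> dv d (v y))" for y s
  have E_D0: "D0 (\<lambda>e. E (t e) (s e))" if "tm t" "tm s" for t s
    unfolding E_def
    by (intro D0_intros D0_dv v_tm tm_intros tm_subst[OF that(1) simples_rename[of Suc]]
        tm_subst[OF that(2) simples_rename[of Suc]] that)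
  have E_cop: "d = \<one>" if "\<not> E y s" "\<zero> \<prec> s" "dv d (v y)" "dv d s" for d y s
  proof -
    have "d \<noteq> \<zero>" using that(2,4) lt_irrefl by (metis sr.dvd_0_left)
    then have "\<one> \<prec> d \<or> \<one> = d" using zero_min discrete by metis
    moreover have "d \<prec> s \<oplus> \<one>" using dv_le[OF that(4,2)] lt_succ by blast
    ultimately show ?thesis using that(1,3,4) unfolding E_def by blast
  qed
  text \<open>A number s codes the set of those y for which s and v y have a common factor.  A maximal
    code s | N for which infinitely many x violate Q at every y in the set leaves only
    colours y outside the set to consider, and for these P alone decides membership.\<close>
  define Rs where "Rs s x \<longleftrightarrow> (\<forall>y. y \<prec> a \<longrightarrow> E y s \<longrightarrow> \<not> Q x y)" for s x
  have Rs_Sg: "Sg k (\<lambda>e. Rs (s e) (e j))" if "tm s" for s j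
    unfolding Rs_def
    by (intro Sg_ball[OF b] Sg_imp Pg_D0 E_D0 Sg_not defin_rename2[OF Q] tm_intros
        tm_subst[OF that simples_rename[of Suc]])
  let ?X = "\<lambda>s. dv s N \<and> (\<forall>b. \<exists>x. b \<prec> x \<and> Rs s x)"
  have "\<exists>s. ?X s \<and> (\<forall>t. s \<prec> t \<longrightarrow> \<not> ?X t)"
  proof (rule maximal_Pg[OF IS, of ?X])
    show "Pg (Suc k) (\<lambda>e. ?X (e 0))"
      unfolding k' by (intro Pg_and Pg_all Pg_Suc_Sg Sg_ex Sg_and Rs_Sg[unfolded k'] Sg_D0 Pg_D0 D0_intros D0_dv tm_intros)
    have "\<not> E y \<one>" for y unfolding E_def lt_succ le_def using lt_irrefl lt_trans by blast
    then have "Rs \<one> x" for x unfolding Rs_def by blast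
    then show "?X \<one>" using lt_add_one sr.one_dvd by blast
    show "s \<preceq> N" if "?X s" for s using that dv_le N(1) by blast
  qed
  then obtain s where s: "dv s N" "\<And>b. \<exists>x. b \<prec> x \<and> Rs s x" "\<And>t. s \<prec> t \<Longrightarrow> \<not> ?X t" by blast
  have s0: "\<zero> \<prec> s" using s(1) N(1) zero_min[of s] lt_irrefl by (metis sr.dvd_0_left)
  have bound: "\<exists>b. \<forall>x. b \<prec> x \<longrightarrow> Rs s x \<longrightarrow> Q x y" if y: "y \<prec> a" "\<not> E y s" for y
  proof -
    let ?t = "s \<otimes> v y"
    have "s \<prec> ?t" using mul_mono[OF s0 v1[of y]] mul_one mul_comm by metis
    obtain q where q: "N = s \<otimes> q" using s(1) by (rule sr.dvdE)
    have "dv (v y) q"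
      using gauss[OF IS0 v0, of y s q] N(2)[OF y(1)] E_cop[OF y(2) s0] q by blast
    then have "dv ?t N" unfolding q by (rule sr.mult_dvd_mono[OF sr.dvd_refl])
    \<comment> \<open>The product is a larger divisor of N, so by maximality of s it must lose the
      unboundedness clause.\<close>
    with s(3)[OF \<open>s \<prec> ?t\<close>] obtain b where b: "\<And>x. b \<prec> x \<Longrightarrow> \<not> Rs ?t x" by blast
    \<comment> \<open>Only y can be new: a factor d of \<open>v z\<close> that is coprime to s
      divides \<open>v y\<close>, and distinct moduli are coprime. If x satisfies
      \<open>Rs s x\<close> but not \<open>Rs ?t x\<close>, then Q x y must hold.\<close>
    have E: "E z s \<or> z = y" if z: "z \<prec> a" "E z ?t" for z
    proof (rule ccontr)
      assume neg: "\<not> (E z s \<or> z = y)"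
      obtain d where d: "\<one> \<prec> d" "dv d ?t" "dv d (v z)" using z(2) unfolding E_def by blast
      have "dv d (v y)"
      proof (rule gauss[OF IS0 _ d(2)])
        show "\<zero> \<prec> d" using d(1) zero_lt_one lt_trans by blast
        show "x = \<one>" if "dv x d" "dv x s" for x
          using E_cop[of z s x] neg s0 that d(3) sr.dvd_trans by blast
      qed
      then have "d = \<one>"
        using godel_moduli_coprime[OF IS0 m(2), of a y z d] y(1) z(1) neg d(3) unfolding v_def by blast
      then show False using d(1) lt_irrefl by simp
    qed
    have "Q x y" if "b \<prec> x" "Rs s x" for x
      using b[OF that(1)] that(2) E unfolding Rs_def by blast
    then show ?thesis by blast
  qed
  \<comment> \<open>Q is absent on purpose: with the Sigma_k premise P alone the condition is Pi_k.
    For y outside the coded set it still holds from some w on, because there Q is automatic and P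
    and Q together are bounded.\<close>
  let ?C = "\<lambda>w y. \<forall>x. w \<prec> x \<longrightarrow> Rs s x \<and> P x y \<longrightarrow> E y s"
  have C: "\<exists>w. ?C w y" if y: "y \<prec> a" for y
  proof (cases "E y s")
    case False
    obtain b where b: "\<And>x. b \<prec> x \<Longrightarrow> Rs s x \<Longrightarrow> Q x y" using bound[OF y False] by blast
    obtain c where c: "\<And>x. c \<prec> x \<Longrightarrow> \<not> (P x y \<and> Q x y)" using no y by blast
    have "b \<prec> b \<oplus> c \<oplus> \<one>" "c \<prec> b \<oplus> c \<oplus> \<one>" by (rule lt_add_add_one)+
    then have "?C (b \<oplus> c \<oplus> \<one>) y" using b c lt_trans by blast
    then show ?thesis by blast
  qed blast
  have "Pg k (\<lambda>e. ?C (e 0) (e 1))"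
    unfolding k' by (intro Pg_all Pg_imp Sg_and Rs_Sg[unfolded k'] defin_rename2[OF P[unfolded k']] Sg_D0 Pg_D0 D0_intros E_D0 tm_intros)
  from collection[OF b IS this C] obtain w where
    w: "\<And>y. y \<prec> a \<Longrightarrow> \<exists>u. u \<prec> w \<and> ?C u y" by blast
  \<comment> \<open>This x lies beyond all the bounds at once, so its colour belongs to the coded
    set; but there \<open>Rs s x\<close> refutes Q.\<close>
  obtain x where x: "w \<prec> x" "Rs s x" using s(2) by blast
  obtain y where y: "y \<prec> a" "P x y" "Q x y" using all by blast
  obtain u where "u \<prec> w" "?C u y" using w[OF y(1)] by blast
  then have "E y s" using x y(2) lt_trans by blast
  then show False using x(2) y(1,3) unfolding Rs_def by blast
qed

section \<open>Axiom schemes in a model\<close>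

lemma defin_sat: "C p \<Longrightarrow> defin M C (\<lambda>e. sat M e p)"
  unfolding defin_def using simples_id by blast

lemma sat_ind_iff_IS: "(\<forall>p. sigma k p \<longrightarrow> (\<forall>e. sat M e (ind p))) \<longleftrightarrow> IS k"
proof
  assume *: "\<forall>p. sigma k p \<longrightarrow> (\<forall>e. sat M e (ind p))"
  show "IS k" unfolding IS_def
  proof (intro allI impI)
    fix Z x
    assume Z: "Sg k (\<lambda>e. Z (e 0))" "Z \<zero>" "\<forall>x. Z x \<longrightarrow> Z (x \<oplus> \<one>)"
    obtain p \<sigma> where p: "sigma k p" "\<And>x e. Z ((x ## e) 0) = sat M (x ## \<sigma> e) p"
      by (rule defin_scons[OF rename_closed(2) Z(1)]) (rule that)
    \<comment> \<open>Z reads only the head, so any tail can serve; the constant zero tail is an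
      arbitrary choice.\<close>
    have "sat M (\<sigma> (\<lambda>_. \<zero>)) (ind p)" using * p(1) by blast
    then show "Z x" using Z(2,3) by (simp add: sat_ind flip: p(2))
  qed
next
  assume IS: "IS k"
  show "\<forall>p. sigma k p \<longrightarrow> (\<forall>e. sat M e (ind p))"
  proof (intro allI impI)
    fix p e assume p: "sigma k p"
    have "Sg k (\<lambda>e'. sat M (e' 0 ## e) p)"
      by (intro defin_subst[OF defin_sat] simples_intros p)
    from IS_induct[OF IS this] show "sat M e (ind p)" by (simp add: sat_ind)
  qed
qed

text \<open>Splitting off the head twice brings x to index 0 and y to index 1, as \<open>WR\<close>
  expects. Both formulas undergo only a renaming, so their conjunction is literally of the shape
  required by \<open>sigma_and_pi\<close>.\<close>

lemma WRs_of_sat_WR: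
  assumes *: "\<And>p e. sigma_and_pi k p \<Longrightarrow> sat M e (WR p)"
  shows "WRs k"
  unfolding WRs_def
proof (intro allI impI)
  fix P Q a
  assume P: "Sg k (\<lambda>e. P (e 0) (e 1))" and Q: "Pg k (\<lambda>e. Q (e 0) (e 1))"
    and all: "\<forall>x. \<exists>y. y \<prec> a \<and> P x y \<and> Q x y"
  obtain p q \<sigma> where pq: "sigma k p" "pi k q" "simples \<sigma>"
    "(\<lambda>e. P (e 0) (e 1)) = (\<lambda>e. sat M (\<sigma> e) p)" "(\<lambda>e. Q (e 0) (e 1)) = (\<lambda>e. sat M (\<sigma> e) q)"
    using defin_pair[OF rename_closed(2,3) P Q] by blast
  obtain f \<tau> where f: "simples \<tau>" "\<And>x e. \<sigma> (x ## e) = (x ## \<tau> e) \<circ> f"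
    using simples_scons_split[OF pq(3)] by metis
  obtain g \<rho> where g: "simples \<rho>" "\<And>x e. \<tau> (x ## e) = (x ## \<rho> e) \<circ> g"
    using simples_scons_split[OF f(1)] by metis
  let ?h = "shiftr g \<circ> f"
  let ?e = "\<rho> (\<lambda>_. \<zero>)"
  have \<sigma>: "\<sigma> (x ## y ## (\<lambda>_. \<zero>)) = (x ## y ## ?e) \<circ> ?h" for x y
    by (simp add: f(2) g(2) scons_shiftr flip: comp_assoc)
  have PQ: "P x y = sat M (x ## y ## ?e) (rename_fm ?h p)" "Q x y = sat M (x ## y ## ?e) (rename_fm ?h q)" for x y
    using fun_cong[OF pq(4), of "x ## y ## (\<lambda>_. \<zero>)"] fun_cong[OF pq(5), of "x ## y ## (\<lambda>_. \<zero>)"]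
    by (simp_all only: sat_rename \<sigma> scons_simps scons_numeral)
  have "sigma_and_pi k (FAnd (rename_fm ?h p) (rename_fm ?h q))"
    using sigma_rename[OF pq(1)] pi_rename[OF pq(2)] unfolding sigma_and_pi_def by blast
  from *[OF this, unfolded sat_WR, rule_format, of a ?e] all
  show "\<exists>y. y \<prec> a \<and> (\<forall>b. \<exists>x. b \<prec> x \<and> P x y \<and> Q x y)" by (simp add: PQ)
qed

lemma sat_WR_of_WRs:
  assumes WR: "WRs k" and "sigma_and_pi k p"
  shows "sat M e (WR p)"
proof -
  obtain s q where p: "sigma k s" "pi k q" "p = FAnd s q"
    using assms(2) unfolding sigma_and_pi_def by blast
  have "Sg k (\<lambda>e'. sat M (e' 0 ## e' 1 ## e) s)" "Pg k (\<lambda>e'. sat M (e' 0 ## e' 1 ## e) q)" for e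
    by (intro defin_subst[OF defin_sat] simples_intros p)+
  from WR[unfolded WRs_def, rule_format, OF this] show ?thesis unfolding sat_WR p(3) sat.simps by blast
qed

end

lemma ax_closed:
  "PAminus \<subseteq> range close" "ISigma k \<subseteq> range close" "WR_thy \<Gamma> \<subseteq> range close"
  by (auto simp: PAminus_def ISigma_def WR_thy_def IDelta0_def WR_def)

lemma sat_range_close:
  assumes "T \<subseteq> range close" "\<And>p. p \<in> T \<Longrightarrow> sat M e p" "p \<in> T"
  shows "sat M e' p"
  using assms fv_close sat_sentence by (metis imageE subsetD)

text \<open>Axioms are sentences, so truth in one environment gives truth in all, and only models
  with universe nat have to be compared.\<close>

lemma prv_of_models:
  assumes "T \<subseteq> range close" "PAminus \<subseteq> T" "U \<subseteq> range close"
    and "\<And>(M :: nat str) p e. pa_model M \<Longrightarrow> (\<And>q e. q \<in> T \<Longrightarrow> sat M e q) \<Longrightarrow> p \<in> U \<Longrightarrow> sat M e p"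
  shows "\<forall>p \<in> U. prv T p"
proof
  fix p assume p: "p \<in> U"
  show "prv T p"
  proof (rule completeness)
    show "fv_fm q = {}" if "q \<in> T" for q using that assms(1) fv_close by blast
    show "fv_fm p = {}" using p assms(3) fv_close by blast
    fix M :: "nat str" and e assume "\<And>q. q \<in> T \<Longrightarrow> sat M e q"
    then have T: "sat M e q" if "q \<in> T" for q e using sat_range_close[OF assms(1)] that by blast
    then have "pa_model M" using assms(2) by (unfold_locales) blast
    then show "sat M e p" using assms(4) T p by blast
  qed (fact assms(2))
qed

theorem theorem5p9:
  fixes n :: nat
  shows "(\<forall>p \<in> ISigma (n + 2). prv (WR_thy (sigma_and_pi (n + 1))) p)
       \<and> (\<forall>p \<in> WR_thy (sigma_and_pi (n + 1)). prv (ISigma (n + 2)) p)"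
proof
  show "\<forall>p \<in> ISigma (n + 2). prv (WR_thy (sigma_and_pi (n + 1))) p"
  proof (rule prv_of_models[OF ax_closed(3) _ ax_closed(2)])
    show "PAminus \<subseteq> WR_thy (sigma_and_pi (n + 1))" by (auto simp: WR_thy_def IDelta0_def)
    fix M :: "nat str" and p e
    assume "pa_model M" and T: "\<And>q e. q \<in> WR_thy (sigma_and_pi (n + 1)) \<Longrightarrow> sat M e q" and p: "p \<in> ISigma (n + 2)"
    interpret pa_model M by fact
    have "sat M e (ind q)" if "sigma 0 q" for q e
    proof -
      have "delta0 q" using that by (auto elim: sigma.cases)
      then have "close (ind q) \<in> WR_thy (sigma_and_pi (n + 1))" unfolding WR_thy_def IDelta0_def by blast
      from T[OF this] show ?thesis unfolding sat_close by blast
    qed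
    then have IS0: "IS 0" using sat_ind_iff_IS by blast
    have WR: "WRs (n + 1)"
      by (rule WRs_of_sat_WR, rule T) (auto simp: WR_thy_def)
    \<comment> \<open>Passing from k to k + 1 uses weak regularity at level k, which
      \<open>WRs_mono\<close> derives from level n + 1.\<close>
    have "IS k" if "k \<le> n + 2" for k
      using that
    proof (induction k)
      case (Suc k)
      then show ?case using IS_Suc_of_WRs WRs_mono[OF WR, of k] by simp
    qed (rule IS0)
    then have "sigma (n + 2) q \<Longrightarrow> sat M e (close (ind q))" for q
      using sat_ind_iff_IS sat_close by blast
    then show "sat M e p" using p sat_PAminus unfolding ISigma_def by blast
  qed
  show "\<forall>p \<in> WR_thy (sigma_and_pi (n + 1)). prv (ISigma (n + 2)) p"
  proof (rule prv_of_models[OF ax_closed(2) _ ax_closed(3)])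
    show "PAminus \<subseteq> ISigma (n + 2)" by (auto simp: ISigma_def)
    fix M :: "nat str" and p e
    assume "pa_model M" and T: "\<And>q e. q \<in> ISigma (n + 2) \<Longrightarrow> sat M e q" and p: "p \<in> WR_thy (sigma_and_pi (n + 1))"
    interpret pa_model M by fact
    have "sat M e (ind q)" if "sigma (n + 2) q" for q e
    proof -
      have "close (ind q) \<in> ISigma (n + 2)" using that unfolding ISigma_def by blast
      from T[OF this] show ?thesis unfolding sat_close by blast
    qed
    then have IS: "IS (n + 2)" using sat_ind_iff_IS by blast
    then have WR: "WRs (n + 1)" using WRs_of_IS[of "n + 1"] by simp
    have "sat M e (close (ind q))" if "delta0 q" for q
      using sat_ind_iff_IS[of "n + 2"] IS sigma_mono[OF sigma_pi.intros(1)[OF that]] sat_close by blast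
    then show "sat M e p"
      using p sat_PAminus sat_WR_of_WRs[OF WR] unfolding WR_thy_def IDelta0_def by blast
  qed
qed

end
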